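(* Assume $0<\mu<\bar\lambda$ and $p>1$, and let $p^\star=1+\frac{2}{\tau^+}$ and $p^{\star\star}=1+\frac{2}{\tau^-}$. Consider the equation $$\mathcal{M}^+(D^2u)+\mu\frac{u}{r^2}=u^p\quad\text{in } B_1\setminus\{0\}. \qquad (E)$$ Then: 1. If $p<p^\star$, then (E) has at least one solution $u$ satisfying $r^{\frac{2}{p-1}}u(r)\to K$ as $r\to 0$, at least one solution $v$ satisfying $r^{\tau^+}v(r)\to c_1$ as $r\to 0$ for some constant $c_1>0$, and at least one solution $w$ satisfying $r^{\tau^-}w(r)\to c_2$ as $r\to 0$ for some constant $c_2>0$, where $K=\left[\Lambda\left(\frac{2}{p-1}-\tau^+\right)\left(\frac{2}{p-1}-\tau^-\right)\right]^{\frac{1}{p-1}}$. 2. If $p^\star\le p<p^{\star\star}$, then (E) has at least one solution $u$ satisfying $r^{\tau^-}u(r)\to c_2$ as $r\to 0$ for some constant $c_2>0$. 3. If $p=p^{\star\star}$, then (E) has at least one solution $u$ satisfying $r^{\tau^-}(-\log r)^{\tau^-/2}u(r)\to\bar K$ as $r\to 0$, where $\bar K=\left[\Lambda\tau^-(\tau-\tau^-)\right]^{\tau^-/2}$. 4. If $p>p^{\star\star}$, then (E) has at least one solution $u$ satisfying $r^{\frac{2}{p-1}}u(r)\to K$ as $r\to 0$, with $K=\left[\Lambda\left(\frac{2}{p-1}-\tau^+\right)\left(\frac{2}{p-1}-\tau^-\right)\right]^{\frac{1}{p-1}}$.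
   Context: Let $N$ be the space dimension, $0<\lambda\le\Lambda$, and for a symmetric $N\times N$ matrix $M$ with eigenvalues $\mu_1,\dots,\mu_N$ let $\mathcal{M}^+(M)=\Lambda\sum_{\mu_i>0}\mu_i+\lambda\sum_{\mu_i<0}\mu_i$ (Pucci's sup-operator). Set $\tilde N_+=\frac{\lambda}{\Lambda}(N-1)+1$, assume $\tilde N_+>2$, and put $\tau=\frac{\tilde N_+-2}{2}>0$, $\bar\lambda=\Lambda\tau^2$, and, for $0<\mu<\bar\lambda$, $\tau^\pm=\tau\pm\sqrt{\tau^2-\frac{\mu}{\Lambda}}$, so that $0<\tau^-<\tau<\tau^+$. $B_1$ is the open unit ball of $\mathbb{R}^N$ centered at the origin and $r=|x|$. A "solution" means a strictly positive radial function $u(x)=u(|x|)=u(r)$ of class $C^2$ in $B_1\setminus\{0\}$ satisfying the equation pointwise there. *)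

theory Defs
  imports "HOL-Analysis.Analysis"
begin

definition eigenspace :: "real^'n^'n \<Rightarrow> real \<Rightarrow> (real^'n) set" where
  "eigenspace M m = {v. M *v v = m *\<^sub>R v}"

definition eigenvalues :: "real^'n^'n \<Rightarrow> real set" where
  "eigenvalues M = {m. \<exists>v. v \<noteq> 0 \<and> M *v v = m *\<^sub>R v}"

(* Each distinct eigenvalue is weighted by the dimension of its eigenspace; for symmetric M this
   is its multiplicity in the list mu_1, ..., mu_N. *)
definition pucci_sup :: "real \<Rightarrow> real \<Rightarrow> real^'n^'n \<Rightarrow> real" where
  "pucci_sup lam Lam M =
     Lam * (\<Sum>m | m \<in> eigenvalues M \<and> m > 0. real (dim (eigenspace M m)) * m)
   + lam * (\<Sum>m | m \<in> eigenvalues M \<and> m < 0. real (dim (eigenspace M m)) * m)"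

definition partial_deriv :: "'n \<Rightarrow> (real^'n \<Rightarrow> real) \<Rightarrow> real^'n \<Rightarrow> real" where
  "partial_deriv i u x = frechet_derivative u (at x) (axis i 1)"

definition hessian :: "(real^'n \<Rightarrow> real) \<Rightarrow> real^'n \<Rightarrow> real^'n^'n" where
  "hessian u x = (\<chi> i j. partial_deriv i (partial_deriv j u) x)"

(* Meant for open S. *)
definition C2_on :: "(real^'n) set \<Rightarrow> (real^'n \<Rightarrow> real) \<Rightarrow> bool" where
  "C2_on S u \<longleftrightarrow>
     (\<forall>x\<in>S. u differentiable (at x)) \<and>
     (\<forall>j. \<forall>x\<in>S. partial_deriv j u differentiable (at x)) \<and>
     continuous_on S (hessian u)"

definition punctured_ball :: "(real^'n) set" where
  "punctured_ball = ball 0 1 - {0}"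

definition radial_on :: "(real^'n) set \<Rightarrow> (real^'n \<Rightarrow> real) \<Rightarrow> bool" where
  "radial_on S u \<longleftrightarrow> (\<exists>\<phi>. \<forall>x\<in>S. u x = \<phi> (norm x))"

definition is_solution ::
  "real \<Rightarrow> real \<Rightarrow> real \<Rightarrow> real \<Rightarrow> (real^'n \<Rightarrow> real) \<Rightarrow> bool" where
  "is_solution lam Lam mu p u \<longleftrightarrow>
     C2_on punctured_ball u \<and> radial_on punctured_ball u \<and>
     (\<forall>x\<in>punctured_ball. u x > 0 \<and>
        pucci_sup lam Lam (hessian u x) + mu * (u x / (norm x)\<^sup>2) = u x powr p)"

end

theory Submission
  imports Defs
begin

text \<open>Put \<open>t = - ln |x|\<close> and \<open>u(x) = U(t)\<close>. Where \<open>u' < 0 < u''\<close> the equation reads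
  \<open>U'' - (\<tau>p + \<tau>m) U' + \<tau>p \<tau>m U = exp (- 2 * t) * U powr p / Lam\<close>, which is a Riccati equation for
  \<open>a = U' / U\<close> driven by \<open>\<xi> = exp (- 2 * t) * U powr (p - 1) / Lam\<close>, and the behaviour of \<open>u\<close> at
  the origin is that of \<open>U\<close> as \<open>t\<close> tends to infinity. The solutions asymptotic to \<open>K\<close> are the pure powers. The
  solution with exponent \<open>\<tau>p\<close> comes from a stable node of the system for \<open>(a, \<xi>)\<close>, hence from a Volterra
  equation solved by contraction. The solutions with exponent \<open>\<tau>m\<close>, including the critical
  logarithmic one, approach a saddle or a semi-hyperbolic point; after blowing it up by
  \<open>a = \<tau>m - \<eta> g\<close> with \<open>\<eta> = Lam \<xi>\<close>, both are obtained from a single contraction in which the unstable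
  component \<open>g\<close> is integrated from infinity. Small initial data keep the sign conditions on all of
  \<open>t > 0\<close>, so no continuation argument is needed.\<close>

subsection \<open>Radial functions and the Pucci operator\<close>

lemma punctured_ball_simps:
  "x \<in> punctured_ball \<longleftrightarrow> 0 < norm x \<and> norm x < 1" "open punctured_ball"
  by (auto simp: punctured_ball_def open_Diff)

lemma axis_nth_if: "axis i c $ j = (if i = j then c else 0)"
  by (auto simp: axis_def)

lemma partial_deriv_eq:
  assumes "(u has_derivative u') (at x)"
  shows "partial_deriv i u x = u' (axis i 1)"
  unfolding partial_deriv_def using frechet_derivative_at[OF assms] by simp

lemma radial_has_derivative:
  fixes x :: "real^'n"
  assumes "x \<noteq> 0" "(\<phi> has_real_derivative d) (at (norm x))"
  shows "((\<lambda>x. \<phi> (norm x)) has_derivative (\<lambda>h. d * (x \<bullet> h / norm x))) (at x)"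
proof -
  have "((\<lambda>x. \<phi> (norm x)) has_derivative (\<lambda>h. d * (h \<bullet> sgn x))) (at x)"
    using has_derivative_compose[OF has_derivative_norm[OF assms(1)]
        assms(2)[unfolded has_field_derivative_def]] by simp
  then show ?thesis
    by (simp add: sgn_div_norm inner_commute divide_inverse mult_ac)
qed

text \<open>The partial derivative is \<open>\<phi>1 r / r\<close> times the coordinate
  \<open>x $ j\<close>, and the product rule gives the Hessian. Writing it as a multiple of the
  identity plus a multiple of the projection onto the line of \<open>x\<close> displays its
  spectrum: \<open>\<phi>2\<close> along \<open>x\<close> and \<open>\<phi>1 r / r\<close> across
  it.\<close>

lemma radial_hessian:
  fixes \<phi> :: "real \<Rightarrow> real"
  defines "u \<equiv> \<lambda>x::real^'n. \<phi> (norm x)"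
  assumes d1: "\<And>r. \<lbrakk>0 < r; r < 1\<rbrakk> \<Longrightarrow> (\<phi> has_real_derivative \<phi>1 r) (at r)"
    and d2: "\<And>r. \<lbrakk>0 < r; r < 1\<rbrakk> \<Longrightarrow> (\<phi>1 has_real_derivative \<phi>2 r) (at r)"
    and c2: "continuous_on {0<..<1} \<phi>2"
  shows "C2_on punctured_ball u"
    and "x \<in> punctured_ball \<Longrightarrow> hessian u x =
      (\<chi> i j. (\<phi>2 (norm x) - \<phi>1 (norm x) / norm x) * (x $ i * x $ j / (norm x)\<^sup>2)
        + (if i = j then \<phi>1 (norm x) / norm x else 0))"
proof -
  have du: "(u has_derivative (\<lambda>h. \<phi>1 (norm x) * (x \<bullet> h / norm x))) (at x)"
    if "x \<in> punctured_ball" for x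
    unfolding u_def using that d1 by (intro radial_has_derivative) (auto simp: punctured_ball_simps)
  have pd: "partial_deriv j u x = \<phi>1 (norm x) / norm x * x $ j" if "x \<in> punctured_ball" for j x
    using partial_deriv_eq[OF du[OF that]] by (simp add: inner_axis)
  have dpd: "(partial_deriv j u has_derivative (\<lambda>h. \<phi>1 (norm x) / norm x * h $ j
      + (\<phi>2 (norm x) - \<phi>1 (norm x) / norm x) / norm x * (x \<bullet> h / norm x) * x $ j)) (at x)"
    if x: "x \<in> punctured_ball" for j x
  proof -
    have nx: "0 < norm x" "norm x < 1" "x \<noteq> 0" using x by (auto simp: punctured_ball_simps)
    have "((\<lambda>r. \<phi>1 r / r) has_real_derivative (\<phi>2 (norm x) - \<phi>1 (norm x) / norm x) / norm x) (at (norm x))"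
      using nx by (auto intro!: derivative_eq_intros d2 simp: field_simps)
    from radial_has_derivative[OF nx(3) this]
    have "((\<lambda>x. \<phi>1 (norm x) / norm x * x $ j) has_derivative (\<lambda>h. \<phi>1 (norm x) / norm x * h $ j
      + (\<phi>2 (norm x) - \<phi>1 (norm x) / norm x) / norm x * (x \<bullet> h / norm x) * x $ j)) (at x)"
      by (intro has_derivative_mult bounded_linear.has_derivative[OF bounded_linear_vec_nth] has_derivative_ident)
    then show ?thesis
      by (rule has_derivative_transform_within_open[OF _ punctured_ball_simps(2) x])
         (simp add: pd)
  qed
  have H: "hessian u x = (\<chi> i j. (\<phi>2 (norm x) - \<phi>1 (norm x) / norm x) * (x $ i * x $ j / (norm x)\<^sup>2)
        + (if i = j then \<phi>1 (norm x) / norm x else 0))" if "x \<in> punctured_ball" for x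
    unfolding hessian_def partial_deriv_eq[OF dpd[OF that]]
    by (simp add: vec_eq_iff inner_axis axis_nth_if power2_eq_square)
  then show "x \<in> punctured_ball \<Longrightarrow> hessian u x =
      (\<chi> i j. (\<phi>2 (norm x) - \<phi>1 (norm x) / norm x) * (x $ i * x $ j / (norm x)\<^sup>2)
        + (if i = j then \<phi>1 (norm x) / norm x else 0))" .
  have c1: "continuous_on {0<..<1} \<phi>1"
    by (rule DERIV_continuous_on, rule has_field_derivative_at_within, rule d2) auto
  have cn: "continuous_on punctured_ball (\<lambda>x::real^'n. \<psi> (norm x))"
    if "continuous_on {0<..<1} \<psi>" for \<psi> :: "real \<Rightarrow> real"
    by (rule continuous_on_compose2[OF that]) (auto intro!: continuous_intros simp: punctured_ball_simps)
  have "continuous_on punctured_ball (hessian u)"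
  proof (subst continuous_on_cong[OF refl H], assumption, intro continuous_on_vec_lambda)
    fix i j :: 'n
    have "continuous_on punctured_ball (\<lambda>x::real^'n. if i = j then \<phi>1 (norm x) / norm x else 0)"
      by (cases "i = j") (auto intro!: continuous_intros cn c1 simp: punctured_ball_simps)
    then show "continuous_on punctured_ball (\<lambda>x::real^'n.
      (\<phi>2 (norm x) - \<phi>1 (norm x) / norm x) * (x $ i * x $ j / (norm x)\<^sup>2) + (if i = j then \<phi>1 (norm x) / norm x else 0))"
      by (intro continuous_on_add) (auto intro!: continuous_intros cn c1 c2 simp: punctured_ball_simps)
  qed
  then show "C2_on punctured_ball u"
    unfolding C2_on_def differentiable_def using du dpd by blast
qed

text \<open>The matrix acts as \<alpha> on the hyperplane orthogonal to \<open>x\<close>, of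
  dimension N - 1, and as \<beta> on the line of \<open>x\<close>. As \<alpha> is negative and
  \<beta> positive, each falls into exactly one of the two sums that define the operator.\<close>

lemma pucci_sup_rank_one_update:
  fixes x :: "real^'n"
  defines "M \<equiv> \<lambda>\<alpha> \<beta>. (\<chi> i j. (\<beta> - \<alpha>) * (x $ i * x $ j / (norm x)\<^sup>2) + (if i = j then \<alpha> else 0))"
  assumes x: "x \<noteq> 0" and N: "CARD('n) \<ge> 2" and ab: "\<alpha> < 0" "0 < \<beta>"
  shows "pucci_sup lam Lam (M \<alpha> \<beta>) = Lam * \<beta> + lam * (real CARD('n) - 1) * \<alpha>"
proof -
  have nx: "norm x > 0" using x by simp
  have Mv: "M \<alpha> \<beta> *v v = ((\<beta> - \<alpha>) * (x \<bullet> v) / (norm x)\<^sup>2) *\<^sub>R x + \<alpha> *\<^sub>R v" for v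
  proof -
    have "(M \<alpha> \<beta> *v v) $ i = (\<beta> - \<alpha>) * (x \<bullet> v) / (norm x)\<^sup>2 * x $ i + \<alpha> * v $ i" for i
    proof -
      have "(M \<alpha> \<beta> *v v) $ i = (\<Sum>j\<in>UNIV. ((\<beta> - \<alpha>) / (norm x)\<^sup>2 * x $ i) * (x $ j * v $ j) + (if i = j then \<alpha> * v $ j else 0))"
        unfolding M_def matrix_vector_mult_def by (auto intro!: sum.cong simp: algebra_simps)
      also have "\<dots> = (\<beta> - \<alpha>) / (norm x)\<^sup>2 * x $ i * (x \<bullet> v) + \<alpha> * v $ i"
        by (simp add: sum.distrib sum_distrib_left inner_vec_def)
      finally show ?thesis by (simp add: mult_ac)
    qed
    then show ?thesis by (simp add: vec_eq_iff)
  qed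
  have Ea: "eigenspace (M \<alpha> \<beta>) \<alpha> = {v. x \<bullet> v = 0}"
    using x ab by (auto simp: eigenspace_def Mv)
  have Mx: "M \<alpha> \<beta> *v x = \<beta> *\<^sub>R x"
    using nx by (simp add: Mv flip: power2_norm_eq_inner scaleR_add_left)
  \<comment> \<open>An eigenvector for any eigenvalue other than \<alpha> is a multiple of
    \<open>x\<close>. This settles both the \<beta>-eigenspace and the absence of further
    eigenvalues.\<close>
  have par: "v = ((\<beta> - \<alpha>) * (x \<bullet> v) / (norm x)\<^sup>2 / (m - \<alpha>)) *\<^sub>R x"
    if "M \<alpha> \<beta> *v v = m *\<^sub>R v" "m \<noteq> \<alpha>" for v m
  proof -
    have "(m - \<alpha>) *\<^sub>R v = ((\<beta> - \<alpha>) * (x \<bullet> v) / (norm x)\<^sup>2) *\<^sub>R x"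
      using that(1) by (simp add: Mv algebra_simps)
    then have "(1 / (m - \<alpha>)) *\<^sub>R ((m - \<alpha>) *\<^sub>R v)
      = (1 / (m - \<alpha>)) *\<^sub>R (((\<beta> - \<alpha>) * (x \<bullet> v) / (norm x)\<^sup>2) *\<^sub>R x)" by simp
    then show ?thesis using that(2) by (simp add: mult.commute)
  qed
  have Eb: "eigenspace (M \<alpha> \<beta>) \<beta> = span {x}"
  proof
    show "eigenspace (M \<alpha> \<beta>) \<beta> \<subseteq> span {x}"
      using par[of _ \<beta>] ab by (force simp: eigenspace_def span_singleton)
    show "span {x} \<subseteq> eigenspace (M \<alpha> \<beta>) \<beta>"
      by (auto simp: eigenspace_def span_singleton matrix_vector_mult_scaleR Mx)
  qed
  have da: "dim (eigenspace (M \<alpha> \<beta>) \<alpha>) = CARD('n) - 1"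
    unfolding Ea using dim_hyperplane[OF x] by simp
  have db: "dim (eigenspace (M \<alpha> \<beta>) \<beta>) = 1"
    unfolding Eb using x by (simp add: dim_span)
  have ev: "eigenvalues (M \<alpha> \<beta>) = {\<alpha>, \<beta>}"
  proof
    show "eigenvalues (M \<alpha> \<beta>) \<subseteq> {\<alpha>, \<beta>}"
    proof
      fix m assume "m \<in> eigenvalues (M \<alpha> \<beta>)"
      then obtain v where v: "v \<noteq> 0" "M \<alpha> \<beta> *v v = m *\<^sub>R v" by (auto simp: eigenvalues_def)
      show "m \<in> {\<alpha>, \<beta>}"
      proof (cases "m = \<alpha>")
        case False
        then obtain c where c: "v = c *\<^sub>R x" using par[OF v(2)] by blast
        then have "m *\<^sub>R v = \<beta> *\<^sub>R v" using v(2) by (auto simp: matrix_vector_mult_scaleR Mx)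
        then show ?thesis using v(1) by simp
      qed simp
    qed
    have "dim (eigenspace (M \<alpha> \<beta>) \<alpha>) \<noteq> 0" using da N by simp
    then have "\<exists>v. v \<noteq> 0 \<and> v \<in> eigenspace (M \<alpha> \<beta>) \<alpha>" by (auto simp: dim_eq_0)
    then show "{\<alpha>, \<beta>} \<subseteq> eigenvalues (M \<alpha> \<beta>)"
      using Mx x by (auto simp: eigenvalues_def eigenspace_def)
  qed
  have "{m. m \<in> eigenvalues (M \<alpha> \<beta>) \<and> m > 0} = {\<beta>}" "{m. m \<in> eigenvalues (M \<alpha> \<beta>) \<and> m < 0} = {\<alpha>}"
    unfolding ev using ab by auto
  then show ?thesis
    unfolding pucci_sup_def using N by (simp add: da db)
qed

text \<open>With \<open>t = - ln r\<close> and \<open>u(r) = U(t)\<close>, the radial equation becomes a Riccati equation for the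
  logarithmic derivative \<open>a = U' / U\<close>. The two sign conditions say \<open>u' < 0 < u''\<close>, which selects
  the branch of the Pucci operator.\<close>
lemma is_solution_of_riccati:
  fixes U a :: "real \<Rightarrow> real" and Lam p :: real
  defines "\<xi> \<equiv> \<lambda>t. exp (- 2 * t) * U t powr (p - 1) / Lam"
  assumes pos: "0 < Lam" "CARD('n::finite) \<ge> 2"
    and lam: "lam * (real CARD('n) - 1) = Lam * (\<tau>p + \<tau>m + 1)" and mu: "mu = Lam * (\<tau>p * \<tau>m)"
    and U: "\<And>t. t > 0 \<Longrightarrow> U t > 0"
    and dU: "\<And>t. t > 0 \<Longrightarrow> (U has_real_derivative a t * U t) (at t)"
    and da: "\<And>t. t > 0 \<Longrightarrow> (a has_real_derivative \<xi> t - (a t - \<tau>p) * (a t - \<tau>m)) (at t)"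
    and a: "\<And>t. t > 0 \<Longrightarrow> a t > 0"
    and convex: "\<And>t. t > 0 \<Longrightarrow> (\<tau>p + \<tau>m + 1) * a t - \<tau>p * \<tau>m + \<xi> t > 0"
  shows "is_solution lam Lam mu p (\<lambda>x::real^'n. U (- ln (norm x)))"
proof -
  \<comment> \<open>\<open>b\<close> is a' + a^2 + a with a' replaced by means of the Riccati
    equation. Hence u'' = b u / r^2, and \<open>convex\<close> says that u'' is positive.\<close>
  define b where "b t = (\<tau>p + \<tau>m + 1) * a t - \<tau>p * \<tau>m + \<xi> t" for t
  define \<phi> where "\<phi> r = U (- ln r)" for r
  define \<phi>1 where "\<phi>1 r = - a (- ln r) * U (- ln r) / r" for r
  define \<phi>2 where "\<phi>2 r = b (- ln r) * U (- ln r) / r\<^sup>2" for r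
  have ln: "- ln r > 0" if "0 < r" "r < 1" for r :: real using that by simp
  have d1: "(\<phi> has_real_derivative \<phi>1 r) (at r)" if "0 < r" "r < 1" for r
    unfolding \<phi>_def \<phi>1_def
    by (rule DERIV_cong[OF DERIV_chain2[where f = U and g = "\<lambda>r. - ln r", OF dU[OF ln[OF that]]]])
       (use that in \<open>auto intro!: derivative_eq_intros\<close>)
  have d2: "(\<phi>1 has_real_derivative \<phi>2 r) (at r)" if r: "0 < r" "r < 1" for r
  proof -
    have l: "((\<lambda>r. - ln r) has_real_derivative (- inverse r)) (at r)"
      using r by (auto intro!: derivative_eq_intros simp: field_simps)
    have A: "((\<lambda>r. a (- ln r)) has_real_derivative (\<xi> (- ln r) - (a (- ln r) - \<tau>p) * (a (- ln r) - \<tau>m)) * (- inverse r)) (at r)"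
      by (rule DERIV_chain2[where f = a and g = "\<lambda>r. - ln r", OF da[OF ln[OF r]] l])
    have B: "((\<lambda>r. U (- ln r)) has_real_derivative (a (- ln r) * U (- ln r)) * (- inverse r)) (at r)"
      by (rule DERIV_chain2[where f = U and g = "\<lambda>r. - ln r", OF dU[OF ln[OF r]] l])
    \<comment> \<open>The identity left over by the quotient rule, over abstract reals with
      \<open>i\<close> in place of \<open>inverse r\<close>, so that it becomes a polynomial
      consequence of \<open>r * i = 1\<close>.\<close>
    have "(- ((x - (y - \<tau>p) * (y - \<tau>m)) * - i) * v + (y * v * - i) * - y) * r - - y * v * 1
        = ((\<tau>p + \<tau>m + 1) * y - \<tau>p * \<tau>m + x) * v" if "r * i = 1" for x y v i :: real
      using that by algebra
    note num = this[of "inverse r"]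
    have "r * inverse r = 1" using r by simp
    note num = num[OF this, of "\<xi> (- ln r)" "a (- ln r)" "U (- ln r)"]
    show ?thesis unfolding \<phi>1_def \<phi>2_def b_def
      by (rule DERIV_cong[OF DERIV_divide[OF DERIV_mult[OF DERIV_minus[OF A] B] DERIV_ident]])
         (use r num in \<open>simp_all only: power2_eq_square\<close>)
  qed
  have cU: "continuous_on {0<..} U"
    by (rule DERIV_continuous_on, rule has_field_derivative_at_within, rule dU) simp
  have ca: "continuous_on {0<..} a"
    by (rule DERIV_continuous_on, rule has_field_derivative_at_within, rule da) simp
  have "continuous_on {0<..<1} (\<lambda>r. f (- ln r))" if "continuous_on {0<..} f" for f :: "real \<Rightarrow> real"
    by (rule continuous_on_compose2[OF that]) (auto intro!: continuous_intros)
  note cc = this[OF cU] this[OF ca]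
  have c2: "continuous_on {0<..<1} \<phi>2"
    unfolding \<phi>2_def b_def \<xi>_def using U[OF ln] pos by (auto intro!: continuous_intros cc simp: less_le)
  have eq: "pucci_sup lam Lam (hessian (\<lambda>x. \<phi> (norm x)) x) + mu * (\<phi> (norm x) / (norm x)\<^sup>2) = \<phi> (norm x) powr p"
    and Upos: "\<phi> (norm x) > 0"
    if x: "x \<in> punctured_ball" for x :: "real^'n"
  proof -
    define r where "r = norm x"
    have r: "0 < r" "r < 1" "x \<noteq> 0" using x by (auto simp: punctured_ball_simps r_def)
    define t where "t = - ln r"
    have t: "t > 0" using r t_def by simp
    have U0: "U t > 0" and a0: "a t > 0" and b0: "b t > 0" using U a convex t by (auto simp: b_def)
    show "\<phi> (norm x) > 0" using U0 by (simp add: \<phi>_def t_def r_def)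
    have s1: "\<phi>1 r / r < 0" using r U0 a0 unfolding \<phi>1_def t_def[symmetric]
      by (auto simp: divide_neg_pos)
    have s2: "0 < \<phi>2 r" using r U0 b0 unfolding \<phi>2_def t_def[symmetric] by auto
    have e: "exp (- 2 * t) = r\<^sup>2"
      using r by (simp add: t_def exp_double)
    have "pucci_sup lam Lam (hessian (\<lambda>x. \<phi> (norm x)) x) = Lam * \<phi>2 r + lam * (real CARD('n) - 1) * (\<phi>1 r / r)"
    proof -
      have "hessian (\<lambda>x. \<phi> (norm x)) x = (\<chi> i j. (\<phi>2 r - \<phi>1 r / r) * (x $ i * x $ j / (norm x)\<^sup>2)
          + (if i = j then \<phi>1 r / r else 0))"
        unfolding r_def by (rule radial_hessian(2)[OF d1 d2 c2 x])
      then show ?thesis using pucci_sup_rank_one_update[OF r(3) pos(2) s1 s2] by simp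
    qed
    also have "\<dots> = Lam * U t * (b t - (\<tau>p + \<tau>m + 1) * a t) / r\<^sup>2"
      unfolding lam \<phi>1_def \<phi>2_def t_def[symmetric] using r by (simp add: field_simps power2_eq_square)
    \<comment> \<open>By the definition of \<open>b\<close> all terms linear in \<open>a\<close> and
      the constant term cancel, and only \<open>\<xi> t\<close>, which carries the nonlinearity,
      survives.\<close>
    finally have "pucci_sup lam Lam (hessian (\<lambda>x. \<phi> (norm x)) x) + mu * (\<phi> r / r\<^sup>2) = Lam * U t * \<xi> t / r\<^sup>2"
      using r unfolding mu \<phi>_def t_def[symmetric] b_def by (simp add: field_simps)
    also have "\<dots> = U t * U t powr (p - 1)"
      using r pos unfolding \<xi>_def e by simp
    also have "\<dots> = U t powr p" using U0 by (simp add: powr_mult_base)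
    finally show "pucci_sup lam Lam (hessian (\<lambda>x. \<phi> (norm x)) x) + mu * (\<phi> (norm x) / (norm x)\<^sup>2) = \<phi> (norm x) powr p"
      by (simp add: r_def \<phi>_def t_def)
  qed
  have "is_solution lam Lam mu p (\<lambda>x::real^'n. \<phi> (norm x))"
    unfolding is_solution_def radial_on_def using radial_hessian(1)[OF d1 d2 c2] eq Upos by auto
  then show ?thesis by (simp add: \<phi>_def)
qed

section \<open>Limits at the origin as limits in t = - ln |x|\<close>

lemma radial_tendsto:
  assumes "(f \<longlongrightarrow> c) at_top"
  shows "((\<lambda>x::real^'n. f (- ln (norm x))) \<longlongrightarrow> c) (at 0)"
proof -
  have "filterlim (\<lambda>x::real^'n. norm x) (at_right 0) (at 0)"
    by (auto simp: filterlim_at eventually_at_filter intro!: tendsto_eq_intros)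
  from filterlim_compose[OF ln_at_0 this]
  have "filterlim (\<lambda>x::real^'n. - ln (norm x)) at_top (at 0)"
    by (simp add: filterlim_uminus_at_bot)
  from filterlim_compose[OF assms this] show ?thesis .
qed

text \<open>A power of r is an exponential in t. Here \<open>U\<close> is arbitrary, so a
  logarithmic weight can be absorbed into it as a power of t.\<close>

lemma radial_powr_tendsto:
  assumes "((\<lambda>t. exp (- \<gamma> * t) * U t) \<longlongrightarrow> c) at_top"
  shows "((\<lambda>x::real^'n. norm x powr \<gamma> * U (- ln (norm x))) \<longlongrightarrow> c) (at 0)"
proof (rule Lim_transform_eventually[OF radial_tendsto[OF assms]])
  show "\<forall>\<^sub>F x::real^'n in at 0. exp (- \<gamma> * - ln (norm x)) * U (- ln (norm x)) = norm x powr \<gamma> * U (- ln (norm x))"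
    by (auto simp: eventually_at_filter powr_def)
qed

subsection \<open>Fixed points and bounded resolvents on the half-line\<close>

text \<open>Banach's theorem on the closed set of bounded continuous functions with values in
  \<open>{lo..hi}\<close>. The hypotheses speak of plain functions and of an arbitrary pointwise
  bound \<open>D\<close> instead of the sup distance, so applications need only pointwise
  estimates.\<close>

lemma bounded_function_fixed_point:
  fixes F :: "(real \<Rightarrow> real) \<Rightarrow> real \<Rightarrow> real"
  assumes lohi: "lo \<le> hi" and c: "0 \<le> c" "c < 1"
    and cont: "\<And>g. \<lbrakk>continuous_on UNIV g; \<And>t. lo \<le> g t \<and> g t \<le> hi\<rbrakk> \<Longrightarrow> continuous_on UNIV (F g)"
    and range: "\<And>g t. \<lbrakk>continuous_on UNIV g; \<And>t. lo \<le> g t \<and> g t \<le> hi\<rbrakk> \<Longrightarrow> lo \<le> F g t \<and> F g t \<le> hi"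
    and contr: "\<And>g h D t. \<lbrakk>continuous_on UNIV g; \<And>t. lo \<le> g t \<and> g t \<le> hi;
      continuous_on UNIV h; \<And>t. lo \<le> h t \<and> h t \<le> hi; \<And>t. \<bar>g t - h t\<bar> \<le> D\<rbrakk> \<Longrightarrow> \<bar>F g t - F h t\<bar> \<le> c * D"
  obtains g where "continuous_on UNIV g" "\<And>t. lo \<le> g t \<and> g t \<le> hi" "\<And>t. F g t = g t"
proof -
  define S where "S = {g :: real \<Rightarrow>\<^sub>C real. \<forall>t. apply_bcontfun g t \<in> {lo..hi}}"
  have "S = PiC UNIV (\<lambda>_. {lo..hi})" by (auto simp: S_def mem_PiC_iff Pi_iff)
  then have S: "complete S" by (simp add: complete_eq_closed closed_PiC)
  have "const_bcontfun lo \<in> S" using lohi by (simp add: S_def)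
  then have S': "S \<noteq> {}" by blast
  define \<Phi> where "\<Phi> g = Bcontfun (F (apply_bcontfun g))" for g :: "real \<Rightarrow>\<^sub>C real"
  have SD: "continuous_on UNIV (apply_bcontfun g)" "lo \<le> apply_bcontfun g t \<and> apply_bcontfun g t \<le> hi"
    if "g \<in> S" for g t using that by (auto simp: S_def)
  have \<Phi>: "apply_bcontfun (\<Phi> g) = F (apply_bcontfun g)" if "g \<in> S" for g
    unfolding \<Phi>_def
  proof (rule Bcontfun_inverse, rule bcontfun_normI)
    show "continuous_on UNIV (F (apply_bcontfun g))" using cont SD that by blast
    show "norm (F (apply_bcontfun g) t) \<le> \<bar>lo\<bar> + \<bar>hi\<bar>" for t
      using range[OF SD[OF that], of t] by (auto simp: abs_le_iff)
  qed
  have "\<Phi> ` S \<subseteq> S"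
    using range[OF SD] by (auto simp: S_def[symmetric] \<Phi>) (auto simp: S_def \<Phi>)
  moreover have "dist (\<Phi> g) (\<Phi> h) \<le> c * dist g h" if "g \<in> S" "h \<in> S" for g h
  proof (rule dist_bound)
    fix t
    have "\<bar>apply_bcontfun g s - apply_bcontfun h s\<bar> \<le> dist g h" for s
      using dist_bounded[of g s h] by (simp add: dist_real_def)
    from contr[OF SD[OF that(1)] SD[OF that(2)] this]
    show "dist (apply_bcontfun (\<Phi> g) t) (apply_bcontfun (\<Phi> h) t) \<le> c * dist g h"
      using that by (simp add: \<Phi> dist_real_def)
  qed
  ultimately obtain g where "g \<in> S" "\<Phi> g = g" using Banach_fix[OF S S' c] by blast
  then show ?thesis using that[of "apply_bcontfun g"] SD \<Phi> by metis
qed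

lemma integral_from_zero_deriv:
  fixes f :: "real \<Rightarrow> real"
  assumes "continuous_on UNIV f" "0 < t"
  shows "((\<lambda>t. integral {0..t} f) has_real_derivative f t) (at t)"
proof -
  have "((\<lambda>t. integral {0..t} f) has_real_derivative f t) (at t within {0..t + 1})"
    by (rule integral_has_real_derivative[OF continuous_on_subset[OF assms(1)]]) (use assms(2) in auto)
  moreover have "at t within {0..t + 1} = at t"
    by (rule at_within_interior) (use assms(2) in simp)
  ultimately show ?thesis by (simp only:)
qed

text \<open>The cutoff \<open>max 0 t\<close> continues half-line integrals as constants to negative
  times. Operators built from them thus act on functions continuous on the whole line, as the fixed
  point lemma demands.\<close>

lemma continuous_on_integral_from_zero:
  fixes f :: "real \<Rightarrow> real"
  assumes "continuous_on UNIV f"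
  shows "continuous_on UNIV (\<lambda>t. integral {0..max 0 t} f)"
proof -
  have "isCont (\<lambda>t. integral {0..max 0 t} f) x" for x
  proof -
    have "continuous_on {0..max 0 x + 1} (\<lambda>t. integral {0..t} f)"
      by (intro indefinite_integral_continuous_1 integrable_continuous_real continuous_on_subset[OF assms]) simp
    then have "continuous_on {..x + 1} (\<lambda>t. integral {0..max 0 t} f)"
      by (rule continuous_on_compose2) (auto intro!: continuous_intros)
    then have "continuous_on {..<x + 1} (\<lambda>t. integral {0..max 0 t} f)"
      by (rule continuous_on_subset) auto
    then show ?thesis by (simp add: continuous_on_eq_continuous_at)
  qed
  then show ?thesis by (simp add: continuous_on_eq_continuous_at)
qed

section \<open>The equation G' = \<kappa> G - f integrated from infinity\<close>

text \<open>For bounded continuous \<open>f\<close> and \<open>\<kappa> > 0\<close>, the only bounded solution on \<open>[0, \<infinity>)\<close> of \<open>G' = \<kappa> G - f\<close>.\<close>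
definition bounded_resolvent :: "real \<Rightarrow> (real \<Rightarrow> real) \<Rightarrow> real \<Rightarrow> real" where
  "bounded_resolvent \<kappa> f t = exp (\<kappa> * t) * integral {t..} (\<lambda>s. exp (- \<kappa> * s) * f s)"

lemma bounded_resolvent_integrable:
  fixes f :: "real \<Rightarrow> real"
  assumes "0 < \<kappa>" and f: "continuous_on UNIV f" and b: "\<And>s. s \<ge> t \<Longrightarrow> \<bar>f s\<bar> \<le> M"
  shows "(\<lambda>s. exp (- \<kappa> * s) * f s) integrable_on {t..}"
proof (rule measurable_bounded_by_integrable_imp_integrable)
  show "(\<lambda>s. M * exp (- \<kappa> * s)) integrable_on {t..}"
    by (intro integrable_on_mult_right integrable_on_exp_minus_to_infinity assms)
  show "(\<lambda>s. exp (- \<kappa> * s) * f s) \<in> borel_measurable (lebesgue_on {t..})"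
    by (intro continuous_imp_measurable_on_sets_lebesgue continuous_intros continuous_on_subset[OF f]) auto
qed (use b in \<open>auto simp: abs_mult\<close>)

text \<open>The weight \<open>exp (- \<kappa> * s)\<close> has mass
  \<open>exp (- \<kappa> * t) / \<kappa>\<close> on \<open>{t..}\<close>, so the resolvent is 1 /
  \<kappa> times a weighted average of the values of \<open>f\<close> after time \<open>t\<close>.
  This serves for invariant ranges, for contraction estimates, and for limits, where only the tail
  of \<open>f\<close> matters.\<close>

lemma bounded_resolvent_bounds:
  fixes f :: "real \<Rightarrow> real"
  assumes "0 < \<kappa>" and f: "continuous_on UNIV f" and b: "\<And>s. s \<ge> t \<Longrightarrow> lo \<le> f s \<and> f s \<le> hi"
  shows "lo / \<kappa> \<le> bounded_resolvent \<kappa> f t" "bounded_resolvent \<kappa> f t \<le> hi / \<kappa>"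
proof -
  have "(\<lambda>s. exp (- \<kappa> * s) * f s) integrable_on {t..}"
    by (rule bounded_resolvent_integrable[OF assms(1,2), where M = "\<bar>lo\<bar> + \<bar>hi\<bar>"]) (use b in force)
  then have I: "((\<lambda>s. exp (- \<kappa> * s) * f s) has_integral integral {t..} (\<lambda>s. exp (- \<kappa> * s) * f s)) {t..}"
    by (rule integrable_integral)
  have E: "((\<lambda>s. exp (- \<kappa> * s) * c) has_integral exp (- \<kappa> * t) / \<kappa> * c) {t..}" for c
    by (intro has_integral_mult_left has_integral_exp_minus_to_infinity assms)
  have "exp (- \<kappa> * t) / \<kappa> * lo \<le> integral {t..} (\<lambda>s. exp (- \<kappa> * s) * f s)"
    by (rule has_integral_le[OF E I]) (use b in auto)
  from mult_left_mono[OF this, of "exp (\<kappa> * t)"]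
  show "lo / \<kappa> \<le> bounded_resolvent \<kappa> f t" by (simp add: bounded_resolvent_def exp_minus field_simps)
  have "integral {t..} (\<lambda>s. exp (- \<kappa> * s) * f s) \<le> exp (- \<kappa> * t) / \<kappa> * hi"
    by (rule has_integral_le[OF I E]) (use b in auto)
  from mult_left_mono[OF this, of "exp (\<kappa> * t)"]
  show "bounded_resolvent \<kappa> f t \<le> hi / \<kappa>" by (simp add: bounded_resolvent_def exp_minus field_simps)
qed

lemma bounded_resolvent_diff:
  fixes f g :: "real \<Rightarrow> real"
  assumes "0 < \<kappa>" and f: "continuous_on UNIV f" and g: "continuous_on UNIV g"
    and "\<And>s. s \<ge> t \<Longrightarrow> \<bar>f s\<bar> \<le> M" "\<And>s. s \<ge> t \<Longrightarrow> \<bar>g s\<bar> \<le> M"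
  shows "bounded_resolvent \<kappa> f t - bounded_resolvent \<kappa> g t = bounded_resolvent \<kappa> (\<lambda>s. f s - g s) t"
  unfolding bounded_resolvent_def right_diff_distrib
  using integral_diff[OF bounded_resolvent_integrable[OF assms(1,2,4), where t = t] bounded_resolvent_integrable[OF assms(1,3,5), where t = t]]
  by (simp add: right_diff_distrib)

text \<open>Trades the moving lower endpoint for a moving upper one, which makes continuity and
  differentiability in \<open>t\<close> accessible.\<close>

lemma bounded_resolvent_split:
  fixes f :: "real \<Rightarrow> real"
  assumes "0 < \<kappa>" and f: "continuous_on UNIV f" and b: "\<And>s. s \<ge> 0 \<Longrightarrow> \<bar>f s\<bar> \<le> M" and "0 \<le> t"
  shows "bounded_resolvent \<kappa> f t = exp (\<kappa> * t) *
    (integral {0..} (\<lambda>s. exp (- \<kappa> * s) * f s) - integral {0..t} (\<lambda>s. exp (- \<kappa> * s) * f s))"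
proof -
  let ?h = "\<lambda>s. exp (- \<kappa> * s) * f s"
  have "(?h has_integral integral {0..t} ?h) {0..t}"
    by (intro integrable_integral integrable_continuous_real continuous_intros continuous_on_subset[OF f]) auto
  moreover have "(?h has_integral integral {t..} ?h) {t..}"
    by (intro integrable_integral bounded_resolvent_integrable[OF assms(1,2), where M = M]) (use assms in auto)
  ultimately have "(?h has_integral (integral {0..t} ?h + integral {t..} ?h)) ({0..t} \<union> {t..})"
    by (rule has_integral_Un) (auto intro: negligible_subset[OF negligible_sing[of t]])
  moreover have ivl: "{0..t} \<union> {t..} = {0..}" using \<open>0 \<le> t\<close> by auto
  ultimately have "integral {0..} ?h = integral {0..t} ?h + integral {t..} ?h"
    using \<open>0 \<le> t\<close> by (simp add: integral_unique ivl)
  then show ?thesis by (simp add: bounded_resolvent_def)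
qed

lemma bounded_resolvent_continuous:
  fixes f :: "real \<Rightarrow> real"
  assumes "0 < \<kappa>" and f: "continuous_on UNIV f" and b: "\<And>s. s \<ge> 0 \<Longrightarrow> \<bar>f s\<bar> \<le> M"
  shows "continuous_on UNIV (\<lambda>t. bounded_resolvent \<kappa> f (max 0 t))"
proof -
  have "continuous_on UNIV (\<lambda>t. exp (\<kappa> * max 0 t) *
    (integral {0..} (\<lambda>s. exp (- \<kappa> * s) * f s) - integral {0..max 0 t} (\<lambda>s. exp (- \<kappa> * s) * f s)))"
    by (intro continuous_intros continuous_on_integral_from_zero f)
  then show ?thesis by (simp add: bounded_resolvent_split[OF assms])
qed

lemma bounded_resolvent_deriv:
  fixes f :: "real \<Rightarrow> real"
  assumes "0 < \<kappa>" and f: "continuous_on UNIV f" and b: "\<And>s. s \<ge> 0 \<Longrightarrow> \<bar>f s\<bar> \<le> M" and "0 < t"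
  shows "(bounded_resolvent \<kappa> f has_real_derivative \<kappa> * bounded_resolvent \<kappa> f t - f t) (at t)"
proof -
  let ?h = "\<lambda>s. exp (- \<kappa> * s) * f s"
  have D: "((\<lambda>t. integral {0..t} ?h) has_real_derivative ?h t) (at t)"
    using \<open>0 < t\<close> by (intro integral_from_zero_deriv continuous_intros f)
  have "((\<lambda>t. exp (\<kappa> * t) * (integral {0..} ?h - integral {0..t} ?h)) has_real_derivative
    \<kappa> * bounded_resolvent \<kappa> f t - f t) (at t)"
  proof (rule DERIV_cong[OF DERIV_mult[OF _ DERIV_diff[OF DERIV_const D]]])
    show "((\<lambda>t. exp (\<kappa> * t)) has_real_derivative \<kappa> * exp (\<kappa> * t)) (at t)"
      by (auto intro!: derivative_eq_intros)
    have "exp (\<kappa> * t) * exp (- \<kappa> * t) = 1" by (simp flip: exp_add)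
    moreover have "bounded_resolvent \<kappa> f t = exp (\<kappa> * t) * (integral {0..} ?h - integral {0..t} ?h)"
      by (rule bounded_resolvent_split) (use assms in auto)
    ultimately show "\<kappa> * exp (\<kappa> * t) * (integral {0..} ?h - integral {0..t} ?h) + (0 - ?h t) * exp (\<kappa> * t)
      = \<kappa> * bounded_resolvent \<kappa> f t - f t"
      by algebra
  qed
  then show ?thesis
  proof (rule has_field_derivative_transform_within_open[of _ _ _ "{0<..}"])
    fix s :: real assume "s \<in> {0<..}"
    then show "exp (\<kappa> * s) * (integral {0..} ?h - integral {0..s} ?h) = bounded_resolvent \<kappa> f s"
      by (intro bounded_resolvent_split[symmetric, OF assms(1-3)]) auto
  qed (use assms(4) in auto)
qed

subsection \<open>Asymptotic profiles\<close>

lemma mono_bounded_tendsto_at_top: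
  fixes f :: "real \<Rightarrow> real"
  assumes mono: "\<And>s t. \<lbrakk>0 < s; s \<le> t\<rbrakk> \<Longrightarrow> f s \<le> f t" and b: "\<And>t. 0 < t \<Longrightarrow> f t \<le> M"
  obtains c where "(f \<longlongrightarrow> c) at_top" "\<And>t. 0 < t \<Longrightarrow> f t \<le> c"
proof -
  have bdd: "bdd_above (f ` {0<..})" using b by (auto simp: bdd_above_def)
  have up: "f t \<le> (SUP t\<in>{0<..}. f t)" if "0 < t" for t
    using that by (intro cSUP_upper bdd) auto
  have "(f \<longlongrightarrow> (SUP t\<in>{0<..}. f t)) at_top"
  proof (rule increasing_tendsto)
    show "\<forall>\<^sub>F t in at_top. f t \<le> (SUP t\<in>{0<..}. f t)"
      using eventually_gt_at_top[of 0] by eventually_elim (rule up)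
    fix x assume "x < (SUP t\<in>{0<..}. f t)"
    then obtain s where s: "0 < s" "x < f s" using less_cSUP_iff[OF _ bdd] by auto
    show "\<forall>\<^sub>F t in at_top. x < f t"
      using eventually_ge_at_top[of s]
    proof eventually_elim
      case (elim t)
      then show ?case using mono[of s t] s by simp
    qed
  qed
  with up that show ?thesis by blast
qed

lemma integral_exp_decay_le:
  fixes f :: "real \<Rightarrow> real"
  assumes "0 < \<delta>" "0 \<le> T" "0 \<le> B" and f: "f integrable_on {0..T}"
    and "\<And>s. \<lbrakk>0 \<le> s; s \<le> T\<rbrakk> \<Longrightarrow> \<bar>f s\<bar> \<le> B * exp (- \<delta> * s)"
  shows "\<bar>integral {0..T} f\<bar> \<le> B / \<delta>"
proof -
  have E: "((\<lambda>s. exp (- \<delta> * s)) has_integral (- exp (- \<delta> * T) / \<delta> - - exp (- \<delta> * 0) / \<delta>)) {0..T}"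
    using assms(1,2)
    by (intro fundamental_theorem_of_calculus)
       (auto intro!: derivative_eq_intros simp flip: has_real_derivative_iff_has_vector_derivative)
  have g: "(\<lambda>s. B * exp (- \<delta> * s)) integrable_on {0..T}"
    by (rule integrable_on_mult_right[OF has_integral_integrable[OF E]])
  have "norm (integral {0..T} f) \<le> integral {0..T} (\<lambda>s. B * exp (- \<delta> * s))"
    by (rule integral_norm_bound_integral[OF f g]) (use assms(5) in auto)
  also have "\<dots> = B * ((1 - exp (- \<delta> * T)) / \<delta>)"
    using integral_unique[OF E] by (simp add: diff_divide_distrib)
  also have "\<dots> \<le> B * (1 / \<delta>)"
    using assms by (intro mult_left_mono divide_right_mono) auto
  finally show ?thesis by simp
qed

section \<open>The profile at the stable node\<close>

text \<open>On \<open>{1..b}\<close> the derivative p x^(p - 1) is at most p b^p because the base is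
  at least 1. Keeping the exponent \<open>p\<close> lets one constant serve both the range and the
  contraction estimate in \<open>regular_profile\<close>.\<close>

lemma powr_lipschitz:
  fixes x y p b :: real
  assumes "p > 1" "x \<in> {1..b}" "y \<in> {1..b}"
  shows "\<bar>x powr p - y powr p\<bar> \<le> p * b powr p * \<bar>x - y\<bar>"
proof -
  have "norm (x powr p - y powr p) \<le> p * b powr p * norm (x - y)"
  proof (rule field_differentiable_bound[where S = "{1..b}" and f' = "\<lambda>x. p * x powr (p - 1)"])
    fix z assume z: "z \<in> {1..b}"
    show "((\<lambda>x. x powr p) has_field_derivative p * z powr (p - 1)) (at z within {1..b})"
      by (rule has_field_derivative_at_within, rule has_real_derivative_powr) (use z in simp)
    have "z powr (p - 1) \<le> z powr p" using z by (intro powr_mono) auto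
    also have "\<dots> \<le> b powr p" using z assms(1) by (intro powr_mono2) auto
    finally show "norm (p * z powr (p - 1)) \<le> p * b powr p" using assms(1) by simp
  qed (use assms in auto)
  then show ?thesis by simp
qed

text \<open>Integrating y'' + 2 d y' = \<epsilon> exp (- \<delta> t) y^p from y(0) = 1, y'(0) = 0
  gives a Volterra equation whose kernel is bounded and whose source decays. For small \<epsilon> it
  is a contraction on functions with values in [1, 2]. The solution is nondecreasing and bounded, so
  it has a positive limit.\<close>

lemma regular_profile:
  fixes d \<delta> p :: real
  assumes d: "d > 0" and \<delta>: "\<delta> > 0" and p: "p > 1"
  obtains \<epsilon> c y z where "\<epsilon> > 0" "c > 0" "\<And>t. t > 0 \<Longrightarrow> y t > 0" "\<And>t. t > 0 \<Longrightarrow> z t \<ge> 0"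
    "\<And>t. t > 0 \<Longrightarrow> (y has_real_derivative z t) (at t)"
    "\<And>t. t > 0 \<Longrightarrow> (z has_real_derivative - 2 * d * z t + \<epsilon> * exp (- \<delta> * t) * y t powr p) (at t)"
    "(y \<longlongrightarrow> c) at_top"
proof -
  \<comment> \<open>The kernel is at most 1 / (2 d) and the exponential integrates to at most 1 /
    \<delta>. This \<epsilon> therefore bounds the integral term by 1 / (2 p), which keeps values in
    [1, 2], and the Lipschitz constant by 1 / 2.\<close>
  define \<epsilon> where "\<epsilon> = d * \<delta> / (p * 2 powr p)"
  have \<epsilon>: "\<epsilon> > 0" using assms by (simp add: \<epsilon>_def)
  define h where "h g s = \<epsilon> * exp (- \<delta> * s) * g s powr p" for g :: "real \<Rightarrow> real" and s
  \<comment> \<open>Green's kernel of y'' + 2 d y' with zero initial data.\<close>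
  define k where "k T s = (1 - exp (- 2 * d * (T - s))) / (2 * d)" for T s
  define F where "F g t = 1 + integral {0..max 0 t} (\<lambda>s. k (max 0 t) s * h g s)" for g :: "real \<Rightarrow> real" and t
  have k: "0 \<le> k T s \<and> k T s \<le> 1 / (2 * d)" if "0 \<le> s" "s \<le> T" for T s
    using that d by (simp add: k_def divide_right_mono)
  have hc: "continuous_on S (h g)" if "continuous_on UNIV g" "\<And>t. 1 \<le> g t \<and> g t \<le> 2" for g S
  proof -
    have "g x \<noteq> 0" for x using that(2)[of x] by linarith
    then show ?thesis
      unfolding h_def by (intro continuous_intros continuous_on_subset[OF that(1)]) auto
  qed
  have kh: "(\<lambda>s. k T s * h g s) integrable_on {0..T}"
    if "continuous_on UNIV g" "\<And>t. 1 \<le> g t \<and> g t \<le> 2" for g T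
    unfolding k_def using d
    by (intro integrable_continuous_real continuous_intros hc that) auto
  \<comment> \<open>The kernel is split so that the time \<open>T\<close> leaves the integrands.
    Continuity and derivatives then reduce to integrals with only a moving endpoint.\<close>
  have F_split: "F g t = 1 + (integral {0..max 0 t} (h g)
      - exp (- 2 * d * max 0 t) * integral {0..max 0 t} (\<lambda>s. exp (2 * d * s) * h g s)) / (2 * d)"
    if "continuous_on UNIV g" "\<And>t. 1 \<le> g t \<and> g t \<le> 2" for g t
  proof -
    let ?T = "max 0 t"
    have "integral {0..?T} (\<lambda>s. k ?T s * h g s)
      = integral {0..?T} (\<lambda>s. h g s / (2 * d) - exp (- 2 * d * ?T) / (2 * d) * (exp (2 * d * s) * h g s))"
    proof (rule integral_cong)
      fix s
      have "exp (- 2 * d * (?T - s)) = exp (- 2 * d * ?T) * exp (2 * d * s)"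
        by (simp add: algebra_simps flip: exp_add)
      then show "k ?T s * h g s = h g s / (2 * d) - exp (- 2 * d * ?T) / (2 * d) * (exp (2 * d * s) * h g s)"
        by (simp only: k_def) (simp add: diff_divide_distrib left_diff_distrib)
    qed
    also have "\<dots> = integral {0..?T} (h g) / (2 * d)
      - exp (- 2 * d * ?T) / (2 * d) * integral {0..?T} (\<lambda>s. exp (2 * d * s) * h g s)"
    proof (subst integral_diff)
      show "(\<lambda>s. h g s / (2 * d)) integrable_on {0..?T}"
        by (intro integrable_continuous_real continuous_on_divide hc[OF that] continuous_on_const) (use d in auto)
      show "(\<lambda>s. exp (- 2 * d * ?T) / (2 * d) * (exp (2 * d * s) * h g s)) integrable_on {0..?T}"
        by (intro integrable_continuous_real continuous_on_mult hc[OF that] continuous_intros)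
    qed (simp only: integral_mult_right integral_divide)
    finally show ?thesis by (simp add: F_def diff_divide_distrib)
  qed
  have range: "1 \<le> F g t \<and> F g t \<le> 2" if g: "continuous_on UNIV g" "\<And>t. 1 \<le> g t \<and> g t \<le> 2" for g t
  proof
    let ?T = "max 0 t"
    have "0 \<le> integral {0..?T} (\<lambda>s. k ?T s * h g s)"
      by (rule integral_nonneg[OF kh[OF g]]) (use k \<epsilon> in \<open>auto simp: h_def\<close>)
    then show "1 \<le> F g t" unfolding F_def by simp
    have "\<bar>integral {0..?T} (\<lambda>s. k ?T s * h g s)\<bar> \<le> (1 / (2 * d) * (\<epsilon> * 2 powr p)) / \<delta>"
    proof (rule integral_exp_decay_le[OF \<delta> _ _ kh[OF g]])
      fix s assume s: "0 \<le> s" "s \<le> ?T"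
      have "g s powr p \<le> 2 powr p" using g(2)[of s] p by (intro powr_mono2) auto
      then have "k ?T s * (\<epsilon> * exp (- \<delta> * s) * g s powr p) \<le> 1 / (2 * d) * (\<epsilon> * exp (- \<delta> * s) * 2 powr p)"
        using k[OF s] \<epsilon> d by (intro mult_mono) auto
      then show "\<bar>k ?T s * h g s\<bar> \<le> 1 / (2 * d) * (\<epsilon> * 2 powr p) * exp (- \<delta> * s)"
        using k[OF s] \<epsilon> by (simp add: h_def mult_ac)
    qed (use \<epsilon> d in auto)
    also have "\<dots> = 1 / (2 * p)" using d \<delta> p by (simp add: \<epsilon>_def)
    also have "\<dots> \<le> 1" using p by simp
    finally show "F g t \<le> 2" by (simp add: F_def)
  qed
  have contr: "\<bar>F g t - F g' t\<bar> \<le> 1 / 2 * D"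
    if g: "continuous_on UNIV g" "\<And>t. 1 \<le> g t \<and> g t \<le> 2"
      and g': "continuous_on UNIV g'" "\<And>t. 1 \<le> g' t \<and> g' t \<le> 2"
      and D: "\<And>t. \<bar>g t - g' t\<bar> \<le> D" for g g' D t
  proof -
    let ?T = "max 0 t"
    have "D \<ge> 0" using D[of 0] by linarith
    have "\<bar>F g t - F g' t\<bar> = \<bar>integral {0..?T} (\<lambda>s. k ?T s * h g s - k ?T s * h g' s)\<bar>"
      unfolding F_def using integral_diff[OF kh[OF g, of ?T] kh[OF g', of ?T]] by simp
    also have "\<dots> \<le> (1 / (2 * d) * (\<epsilon> * (p * 2 powr p * D))) / \<delta>"
    proof (rule integral_exp_decay_le[OF \<delta> _ _ integrable_diff[OF kh[OF g] kh[OF g']]])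
      fix s assume s: "0 \<le> s" "s \<le> ?T"
      have "\<bar>g s powr p - g' s powr p\<bar> \<le> p * 2 powr p * \<bar>g s - g' s\<bar>"
        using g(2)[of s] g'(2)[of s] p by (intro powr_lipschitz) auto
      also have "\<dots> \<le> p * 2 powr p * D" using p D by (intro mult_left_mono) auto
      finally have "k ?T s * (\<epsilon> * exp (- \<delta> * s) * \<bar>g s powr p - g' s powr p\<bar>)
        \<le> 1 / (2 * d) * (\<epsilon> * exp (- \<delta> * s) * (p * 2 powr p * D))"
        using k[OF s] \<epsilon> d by (intro mult_mono) auto
      moreover have "k ?T s * h g s - k ?T s * h g' s = k ?T s * (\<epsilon> * exp (- \<delta> * s)) * (g s powr p - g' s powr p)"
        by (simp add: h_def algebra_simps)
      ultimately show "\<bar>k ?T s * h g s - k ?T s * h g' s\<bar> \<le> 1 / (2 * d) * (\<epsilon> * (p * 2 powr p * D)) * exp (- \<delta> * s)"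
        using k[OF s] \<epsilon> by (simp add: abs_mult mult_ac)
    qed (use \<epsilon> d p \<open>D \<ge> 0\<close> in auto)
    also have "\<dots> = 1 / 2 * D" using d \<delta> p by (simp add: \<epsilon>_def)
    finally show ?thesis .
  qed
  have cont: "continuous_on UNIV (F g)" if g: "continuous_on UNIV g" "\<And>t. 1 \<le> g t \<and> g t \<le> 2" for g
    unfolding F_split[OF g, abs_def] using d
    by (intro continuous_intros continuous_on_integral_from_zero hc g) auto
  obtain y where y: "continuous_on UNIV y" "\<And>t. 1 \<le> y t \<and> y t \<le> 2" "\<And>t. F y t = y t"
  proof (rule bounded_function_fixed_point[of 1 2 "1 / 2" F])
    note obt = that
    show "continuous_on UNIV (F g)" if "continuous_on UNIV g" "\<And>t. 1 \<le> g t \<and> g t \<le> 2" for g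
      by (rule cont[OF that])
    show "1 \<le> F g t \<and> F g t \<le> 2" if "continuous_on UNIV g" "\<And>t. 1 \<le> g t \<and> g t \<le> 2" for g t
      by (rule range[OF that])
    show "\<bar>F g t - F g' t\<bar> \<le> 1 / 2 * D"
      if "continuous_on UNIV g" "\<And>t. 1 \<le> g t \<and> g t \<le> 2"
        "continuous_on UNIV g'" "\<And>t. 1 \<le> g' t \<and> g' t \<le> 2" "\<And>t. \<bar>g t - g' t\<bar> \<le> D" for g g' D t
      by (rule contr[OF that])
    show thesis if "continuous_on UNIV g" "\<And>t. 1 \<le> g t \<and> g t \<le> 2" "\<And>t. F g t = g t" for g
      by (rule obt[OF that])
  qed simp_all
  let ?I = "\<lambda>t. integral {0..t} (\<lambda>s. exp (2 * d * s) * h y s)"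
  define z where "z t = exp (- 2 * d * t) * ?I t" for t
  have ec: "continuous_on S (\<lambda>s. exp (2 * d * s) * h y s)" for S
    by (intro continuous_intros hc y)
  have ex: "exp (- 2 * d * t) * exp (2 * d * t) = 1" for t by (simp flip: exp_add)
  have De: "((\<lambda>t. exp (- 2 * d * t)) has_real_derivative - 2 * d * exp (- 2 * d * t)) (at t)" for t
    by (auto intro!: derivative_eq_intros)
  have DI: "(?I has_real_derivative exp (2 * d * t) * h y t) (at t)" if "t > 0" for t
    using integral_from_zero_deriv[OF ec that] .
  have dz: "(z has_real_derivative - 2 * d * z t + h y t) (at t)" if "t > 0" for t
  proof -
    have "- 2 * d * exp (- 2 * d * t) * ?I t + exp (2 * d * t) * h y t * exp (- 2 * d * t) = - 2 * d * z t + h y t"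
      unfolding z_def using ex[of t] by algebra
    from DERIV_cong[OF DERIV_mult[OF De DI[OF that]] this] show ?thesis
      unfolding z_def[abs_def] .
  qed
  \<comment> \<open>On differentiating this, the source \<open>h y\<close> cancels against the one
    in z' = - 2 d z + h, which leaves y' = z.\<close>
  have yeq: "y t = 1 + (integral {0..t} (h y) - z t) / (2 * d)" if "t > 0" for t
    using F_split[OF y(1,2), of t] that by (simp add: y z_def)
  have dy: "(y has_real_derivative z t) (at t)" if "t > 0" for t
  proof (rule has_field_derivative_transform_within_open[of _ _ _ "{0<..}"])
    show "((\<lambda>t. 1 + (integral {0..t} (h y) - z t) / (2 * d)) has_real_derivative z t) (at t)"
      by (rule DERIV_cong[OF DERIV_add[OF DERIV_const
            DERIV_cdivide[OF DERIV_diff[OF integral_from_zero_deriv[OF hc[OF y(1,2)] that] dz[OF that]]]]])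
         (use d in simp)
  qed (use that yeq in auto)
  have z0: "z t \<ge> 0" if "t > 0" for t
    unfolding z_def using \<epsilon>
    by (intro mult_nonneg_nonneg integral_nonneg integrable_continuous_real ec) (auto simp: h_def)
  have mono: "y s \<le> y t" if "0 < s" "s \<le> t" for s t
  proof (rule DERIV_nonneg_imp_nondecreasing[OF that(2)])
    fix x assume "s \<le> x" "x \<le> t"
    then have "0 < x" using that by simp
    then show "\<exists>w. (y has_real_derivative w) (at x) \<and> 0 \<le> w" using dy z0 by blast
  qed
  obtain c where c: "(y \<longlongrightarrow> c) at_top" "\<And>t. 0 < t \<Longrightarrow> y t \<le> c"
    using mono_bounded_tendsto_at_top[of y 2] mono y(2) by blast
  have "c > 0" "y t > 0" for t using c(2)[of 1] y(2)[of 1] y(2)[of t] by auto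
  with \<epsilon> dy dz z0 c show ?thesis using that[of \<epsilon> c y z] by (simp add: h_def)
qed

section \<open>The profile at the saddle or semi-hyperbolic point\<close>

lemma integral_exp_weight_bounds:
  fixes f :: "real \<Rightarrow> real"
  assumes f: "continuous_on UNIV f" and b: "\<And>s. lo \<le> f s \<and> f s \<le> hi"
  shows "lo * integral {0..T} (\<lambda>s. exp (- \<delta> * s)) \<le> integral {0..T} (\<lambda>s. exp (- \<delta> * s) * f s)"
    and "integral {0..T} (\<lambda>s. exp (- \<delta> * s) * f s) \<le> hi * integral {0..T} (\<lambda>s. exp (- \<delta> * s))"
proof -
  have F: "(\<lambda>s. exp (- \<delta> * s) * f s) integrable_on {0..T}"
    by (intro integrable_continuous_real continuous_on_mult continuous_on_subset[OF f] continuous_intros) auto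
  have C: "(\<lambda>s. c * exp (- \<delta> * s)) integrable_on {0..T}" for c
    by (intro integrable_continuous_real continuous_intros)
  have "integral {0..T} (\<lambda>s. lo * exp (- \<delta> * s)) \<le> integral {0..T} (\<lambda>s. exp (- \<delta> * s) * f s)"
    by (rule integral_le[OF C F]) (simp add: b mult.commute[of _ "exp _"])
  then show "lo * integral {0..T} (\<lambda>s. exp (- \<delta> * s)) \<le> integral {0..T} (\<lambda>s. exp (- \<delta> * s) * f s)"
    by simp
  have "integral {0..T} (\<lambda>s. exp (- \<delta> * s) * f s) \<le> integral {0..T} (\<lambda>s. hi * exp (- \<delta> * s))"
    by (rule integral_le[OF F C]) (simp add: b mult.commute[of _ "exp _"])
  then show "integral {0..T} (\<lambda>s. exp (- \<delta> * s) * f s) \<le> hi * integral {0..T} (\<lambda>s. exp (- \<delta> * s))"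
    by simp
qed

text \<open>In the common denominator one factor is bounded below by \<open>a\<close> and the other
  by \<open>q * (lo * \<tau>)\<close>. The latter cancels the factor \<open>q * \<tau>\<close> of
  the numerator, so the bound does not depend on \<tau>. This makes the estimate uniform in time
  even if the integrals \<open>A\<close> and \<open>B\<close> grow without bound.\<close>

lemma reciprocal_affine_diff:
  fixes a q e lo \<tau> A B D :: real
  assumes "0 < a" "0 < q" "1 \<le> e" "0 < lo" "0 \<le> \<tau>" "lo * \<tau> \<le> A" "lo * \<tau> \<le> B" "\<bar>A - B\<bar> \<le> D * \<tau>" "0 \<le> D"
  shows "\<bar>1 / (e * (a + q * A)) - 1 / (e * (a + q * B))\<bar> \<le> D / (a * lo)"
proof -
  have "0 \<le> lo * \<tau>" using assms by simp
  then have AB: "0 \<le> A" "0 \<le> B" using assms by linarith+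
  then have X: "0 < a + q * A" "0 < a + q * B" using assms by (auto intro: add_pos_nonneg)
  have "1 / (e * (a + q * A)) - 1 / (e * (a + q * B)) = q * (B - A) / (e * ((a + q * A) * (a + q * B)))"
  proof -
    have "1 / (e * x) - 1 / (e * y) = (y - x) / (e * (x * y))" if "0 < x" "0 < y" for x y
      using that assms(3) by (simp add: field_simps)
    from this[OF X] show ?thesis by (simp add: right_diff_distrib)
  qed
  then have "\<bar>1 / (e * (a + q * A)) - 1 / (e * (a + q * B))\<bar> = q * \<bar>A - B\<bar> / (e * ((a + q * A) * (a + q * B)))"
    using X assms by (simp add: abs_mult abs_minus_commute)
  also have "\<dots> \<le> q * (D * \<tau>) / (1 * ((a + q * A) * (a + q * B)))"
    using X assms by (intro frac_le mult_mono mult_left_mono mult_pos_pos mult_nonneg_nonneg) auto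
  also have "\<dots> \<le> D / (a * lo)"
  proof -
    have "a * (q * (lo * \<tau>)) \<le> (a + q * A) * (a + q * B)"
    proof (rule mult_mono)
      have "q * (lo * \<tau>) \<le> q * B" using assms by (intro mult_left_mono) auto
      then show "q * (lo * \<tau>) \<le> a + q * B" using assms by linarith
    qed (use AB X assms in auto)
    from mult_left_mono[OF this \<open>0 \<le> D\<close>]
    have "q * (D * \<tau>) * (a * lo) \<le> D * ((a + q * A) * (a + q * B))" by (simp add: mult_ac)
    then show ?thesis using X assms by (simp add: frac_le_eq divide_le_eq pos_le_divide_eq pos_divide_le_eq)
  qed
  finally show ?thesis .
qed

text \<open>If \<open>U(t)\<close> solves the equation, then \<open>\<eta> = exp (- 2 * t) * U(t) powr (p - 1)\<close> and
  \<open>g = (\<tau>m - U' / U) / \<eta>\<close> satisfy this system. On the invariant line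
  \<open>\<eta> = 0\<close> the component \<open>g\<close> moves exponentially away from its rest point, so it is pinned down by
  boundedness: \<open>g\<close> is obtained by integrating
  backwards from infinity and \<open>\<eta>\<close> forwards from a small initial value.\<close>
lemma center_profile:
  fixes d \<delta> p Lam b :: real
  assumes d: "d > 0" and \<delta>: "\<delta> \<ge> 0" and p: "p > 1" and Lam: "Lam > 0" and b: "b > 0"
  obtains \<eta> g where
    "\<And>t. t > 0 \<Longrightarrow> \<eta> t > 0" "\<And>t. t > 0 \<Longrightarrow> \<eta> t * g t > 0" "\<And>t. t > 0 \<Longrightarrow> \<eta> t * g t \<le> b"
    "\<And>t. t > 0 \<Longrightarrow> (\<eta> has_real_derivative - \<delta> * \<eta> t - (p - 1) * (\<eta> t)\<^sup>2 * g t) (at t)"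
    "\<And>t. t > 0 \<Longrightarrow> (g has_real_derivative (2 * d + \<delta>) * g t - 1 / Lam + p * \<eta> t * (g t)\<^sup>2) (at t)"
    "\<delta> > 0 \<Longrightarrow> \<exists>c>0. ((\<lambda>t. exp (\<delta> * t) * \<eta> t) \<longlongrightarrow> c) at_top"
    "\<delta> = 0 \<Longrightarrow> ((\<lambda>t. t * \<eta> t) \<longlongrightarrow> 2 * d * Lam / (p - 1)) at_top"
proof -
  define \<kappa> where "\<kappa> = 2 * d + \<delta>"
  \<comment> \<open>The rest point of \<open>g\<close> on the line \<eta> = 0, where g' = \<kappa> g
    - 1 / Lam; \<open>g\<close> is sought between half this value and the value itself.\<close>
  define hi where "hi = 1 / (\<kappa> * Lam)"
  define lo where "lo = hi / 2"
  \<comment> \<open>The initial value of \<eta>. The first bound yields the contraction factor 1 /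
    2, the second ensures that \<eta> g never exceeds \<open>b\<close>.\<close>
  define \<eta>0 where "\<eta>0 = min (\<kappa> / (8 * p * hi)) (b / hi)"
  have pos: "\<kappa> > 0" "hi > 0" "lo > 0" "p > 0" "p - 1 > 0"
    using d \<delta> Lam p by (auto simp: \<kappa>_def hi_def lo_def)
  have \<eta>0: "\<eta>0 > 0" using pos b by (simp add: \<eta>0_def)
  have lohi: "lo \<le> hi" using pos by (simp add: lo_def)
  have small: "p * \<eta>0 * hi \<le> \<kappa> / 8" and small': "\<eta>0 * hi \<le> b"
  proof -
    have "\<eta>0 \<le> \<kappa> / (8 * p * hi)" "\<eta>0 \<le> b / hi" by (auto simp: \<eta>0_def)
    then show "p * \<eta>0 * hi \<le> \<kappa> / 8" "\<eta>0 * hi \<le> b" using pos by (auto simp: field_simps)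
  qed
  define J where "J T = integral {0..T} (\<lambda>s. exp (- \<delta> * s))" for T
  define A where "A g T = integral {0..T} (\<lambda>s. exp (- \<delta> * s) * g s)" for g :: "real \<Rightarrow> real" and T
  \<comment> \<open>The \<eta>-equation is of Bernoulli type: 1 / \<eta> satisfies the linear
    equation w' = \<delta> w + (p - 1) g. Solving it explicitly expresses \<eta> through
    \<open>g\<close>, so that \<open>g\<close> is the only unknown of the fixed point
    problem.\<close>
  define E where "E g T = 1 / (exp (\<delta> * T) * (1 / \<eta>0 + (p - 1) * A g T))" for g T
  \<comment> \<open>The equation for \<open>g\<close> now reads g' = \<kappa> g - f, so a bounded
    \<open>g\<close> is the resolvent of its own \<open>f\<close>.\<close>
  define f where "f g s = 1 / Lam - p * E g (max 0 s) * (g s)\<^sup>2" for g s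
  define F where "F g t = bounded_resolvent \<kappa> (f g) (max 0 t)" for g t
  let ?ok = "\<lambda>g :: real \<Rightarrow> real. continuous_on UNIV g \<and> (\<forall>t. lo \<le> g t \<and> g t \<le> hi)"
  have J0: "0 \<le> J T" for T
    unfolding J_def by (intro integral_nonneg integrable_continuous_real continuous_intros) auto
  have A_lo: "lo * J T \<le> A g T" if "?ok g" for g T
    unfolding J_def A_def by (rule integral_exp_weight_bounds(1)) (use that in auto)
  have A0: "0 \<le> A g T" if "?ok g" for g T
    using A_lo[OF that, of T] J0[of T] pos(3) by (smt (verit) mult_nonneg_nonneg)
  have E0: "0 < E g T" "E g T \<le> \<eta>0" if "?ok g" "0 \<le> T" for g T
  proof -
    have "1 / \<eta>0 \<le> 1 / \<eta>0 + (p - 1) * A g T" using A0[OF that(1), of T] pos by simp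
    moreover have e: "1 \<le> exp (\<delta> * T)" using \<delta> that by simp
    ultimately have "1 * (1 / \<eta>0) \<le> exp (\<delta> * T) * (1 / \<eta>0 + (p - 1) * A g T)"
      using \<eta>0 by (intro mult_mono) auto
    moreover have "0 < 1 * (1 / \<eta>0)" using \<eta>0 by simp
    ultimately have *: "0 < exp (\<delta> * T) * (1 / \<eta>0 + (p - 1) * A g T)"
      "1 / \<eta>0 \<le> exp (\<delta> * T) * (1 / \<eta>0 + (p - 1) * A g T)" by linarith+
    then show "0 < E g T" by (simp only: E_def zero_less_divide_1_iff)
    have "E g T \<le> 1 / (1 / \<eta>0)" unfolding E_def using * \<eta>0 by (intro divide_left_mono) auto
    then show "E g T \<le> \<eta>0" by simp
  qed
  have cA: "continuous_on UNIV (\<lambda>s. A g (max 0 s))" if "?ok g" for g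
    unfolding A_def using that by (intro continuous_on_integral_from_zero continuous_on_mult) (auto intro!: continuous_intros)
  have cE: "continuous_on UNIV (\<lambda>s. E g (max 0 s))" if "?ok g" for g
  proof -
    have "exp (\<delta> * max 0 s) * (1 / \<eta>0 + (p - 1) * A g (max 0 s)) \<noteq> 0" for s
      using E0(1)[OF that, of "max 0 s"] by (auto simp: E_def)
    then show ?thesis unfolding E_def
      by (intro continuous_on_divide continuous_on_mult continuous_on_add continuous_on_const cA[OF that]
          continuous_on_exp continuous_on_max continuous_on_id) auto
  qed
  have cf: "continuous_on UNIV (f g)" if "?ok g" for g
    unfolding f_def using that
    by (intro continuous_on_diff continuous_on_mult continuous_on_power continuous_on_const cE) auto
  have sq: "0 \<le> (g s)\<^sup>2" "(g s)\<^sup>2 \<le> hi\<^sup>2" if "?ok g" for g s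
  proof -
    have "0 \<le> g s" "g s \<le> hi" using that pos(3) by (auto intro: order_trans[of 0 lo])
    then show "(g s)\<^sup>2 \<le> hi\<^sup>2" by (intro power_mono)
  qed simp
  have kh: "\<kappa> * hi = 1 / Lam" using pos Lam by (simp add: hi_def)
  have f_upper: "f g s \<le> 1 / Lam" if "?ok g" for g s
    using E0(1)[OF that, of "max 0 s"] sq[OF that, of s] pos by (simp add: f_def)
  \<comment> \<open>The bound \<open>M\<close> is left free: \<open>\<eta>0\<close> gives the
    invariant range, and a bound decaying in time later gives the limit of \<open>g\<close>.\<close>
  have f_lower: "1 / Lam - p * M * hi\<^sup>2 \<le> f g s" if "?ok g" "E g (max 0 s) \<le> M" for g s M
  proof -
    have "0 < E g (max 0 s)" using E0(1)[OF that(1)] by simp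
    then have "p * E g (max 0 s) * (g s)\<^sup>2 \<le> p * M * hi\<^sup>2"
      using that(2) sq[OF that(1), of s] pos by (intro mult_mono) auto
    then show ?thesis by (simp add: f_def)
  qed
  have f_lower': "1 / (2 * Lam) \<le> f g s" if "?ok g" for g s
  proof -
    have "p * \<eta>0 * hi\<^sup>2 \<le> \<kappa> / 8 * hi"
      using mult_right_mono[OF small, of hi] pos by (simp add: power2_eq_square mult_ac)
    also have "\<dots> = 1 / (8 * Lam)" using kh by simp
    also have "\<dots> \<le> 1 / (2 * Lam)" using Lam by (simp add: field_simps)
    finally have "p * \<eta>0 * hi\<^sup>2 \<le> 1 / (2 * Lam)" .
    moreover have "1 / Lam = 2 * (1 / (2 * Lam))" by simp
    ultimately show ?thesis using f_lower[OF that E0(2)[OF that], of s] by simp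
  qed
  have f_abs: "\<bar>f g s\<bar> \<le> 1 / Lam" if "?ok g" for g s
  proof -
    have "0 < 1 / (2 * Lam)" using Lam by simp
    then show ?thesis using f_upper[OF that, of s] f_lower'[OF that, of s] by linarith
  qed
  have range: "lo \<le> F g t \<and> F g t \<le> hi" if "?ok g" for g t
  proof -
    have "1 / (2 * Lam) / \<kappa> \<le> F g t" "F g t \<le> 1 / Lam / \<kappa>"
      unfolding F_def using bounded_resolvent_bounds[OF pos(1) cf[OF that], of "max 0 t" "1 / (2 * Lam)" "1 / Lam"]
        f_lower'[OF that] f_upper[OF that] by blast+
    then show ?thesis by (simp add: lo_def hi_def mult_ac)
  qed
  have cF: "continuous_on UNIV (F g)" if "?ok g" for g
    unfolding F_def[abs_def] by (rule bounded_resolvent_continuous[OF pos(1) cf[OF that] f_abs[OF that]])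
  have contr: "\<bar>F g t - F h t\<bar> \<le> 1 / 2 * D" if g: "?ok g" and h: "?ok h" and D: "\<And>t. \<bar>g t - h t\<bar> \<le> D" for g h D t
  proof -
    have D0: "0 \<le> D" using D[of 0] by linarith
    have cgh: "continuous_on UNIV (\<lambda>s. g s - h s)" using g h by (intro continuous_on_diff) auto
    \<comment> \<open>Both the difference of the two \<open>A\<close> and their lower bounds scale
      with \<open>J T\<close>, hence a bound free of \<open>T\<close>, also for \<delta> = 0, where
      \<open>J T\<close> equals \<open>T\<close>.\<close>
    have E_diff: "\<bar>E g T - E h T\<bar> \<le> D / (1 / \<eta>0 * lo)" if "0 \<le> T" for T
    proof -
      have "A g T - A h T = integral {0..T} (\<lambda>s. exp (- \<delta> * s) * (g s - h s))"
        unfolding A_def right_diff_distrib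
        by (rule integral_diff[symmetric]; rule integrable_continuous_real; rule continuous_on_mult)
           (use g h in \<open>auto intro!: continuous_intros intro: continuous_on_subset\<close>)
      moreover have "- D \<le> g s - h s \<and> g s - h s \<le> D" for s using D[of s] by linarith
      ultimately have "\<bar>A g T - A h T\<bar> \<le> D * J T"
        using integral_exp_weight_bounds[OF cgh, of "- D" D T \<delta>] unfolding J_def by (simp add: abs_le_iff)
      then show ?thesis unfolding E_def
        using \<eta>0 pos \<delta> that J0 D0 A_lo[OF g] A_lo[OF h] by (intro reciprocal_affine_diff) auto
    qed
    have f_diff: "\<bar>f g s - f h s\<bar> \<le> \<kappa> / 2 * D" for s
    proof -
      let ?T = "max 0 s"
      have gs: "0 \<le> g s" "g s \<le> hi" "0 \<le> h s" "h s \<le> hi" using g h pos(3) by (auto intro: order_trans[of 0 lo])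
      have e: "0 < E g ?T" "E g ?T \<le> \<eta>0" using E0[OF g, of ?T] by auto
      have "f h s - f g s = p * (E g ?T * ((g s + h s) * (g s - h s)) + (h s)\<^sup>2 * (E g ?T - E h ?T))"
        by (simp add: f_def power2_eq_square algebra_simps)
      then have "\<bar>f g s - f h s\<bar> = p * \<bar>E g ?T * ((g s + h s) * (g s - h s)) + (h s)\<^sup>2 * (E g ?T - E h ?T)\<bar>"
        using pos by (simp add: abs_minus_commute[of "f g s"] abs_mult)
      also have "\<dots> \<le> p * (E g ?T * ((g s + h s) * \<bar>g s - h s\<bar>) + (h s)\<^sup>2 * \<bar>E g ?T - E h ?T\<bar>)"
        using pos e gs abs_triangle_ineq[of "E g ?T * ((g s + h s) * (g s - h s))" "(h s)\<^sup>2 * (E g ?T - E h ?T)"]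
        by (intro mult_left_mono) (auto simp: abs_mult)
      also have "\<dots> \<le> p * (\<eta>0 * ((hi + hi) * D) + hi\<^sup>2 * (D / (1 / \<eta>0 * lo)))"
      proof -
        have "E g ?T * ((g s + h s) * \<bar>g s - h s\<bar>) \<le> \<eta>0 * ((hi + hi) * D)"
          using e gs D[of s] D0 \<eta>0 pos by (intro mult_mono add_mono) auto
        moreover have "(h s)\<^sup>2 * \<bar>E g ?T - E h ?T\<bar> \<le> hi\<^sup>2 * (D / (1 / \<eta>0 * lo))"
          using sq[OF h, of s] E_diff[of ?T] by (intro mult_mono) auto
        ultimately show ?thesis using pos by (intro mult_left_mono) auto
      qed
      \<comment> \<open>As \<open>lo\<close> is half of \<open>hi\<close>, both summands contribute
        \<open>2 * (p * \<eta>0 * hi) * D\<close>. By \<open>small\<close> the sum is at most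
        \<open>\<kappa> / 2 * D\<close>, and the resolvent divides by \<kappa>.\<close>
      also have "\<dots> = 4 * (p * \<eta>0 * hi) * D"
        using pos \<eta>0 by (simp add: lo_def power2_eq_square field_simps)
      also have "\<dots> \<le> 4 * (\<kappa> / 8) * D" using small D0 by (intro mult_right_mono mult_left_mono) auto
      finally show ?thesis by simp
    qed
    have fb: "- (\<kappa> / 2 * D) \<le> f g s - f h s \<and> f g s - f h s \<le> \<kappa> / 2 * D" for s
      using f_diff[of s] unfolding abs_le_iff by linarith
    have "F g t - F h t = bounded_resolvent \<kappa> (\<lambda>s. f g s - f h s) (max 0 t)"
      unfolding F_def by (rule bounded_resolvent_diff[OF pos(1) cf[OF g] cf[OF h] f_abs[OF g] f_abs[OF h]])
    moreover have "- (\<kappa> / 2 * D) / \<kappa> \<le> bounded_resolvent \<kappa> (\<lambda>s. f g s - f h s) (max 0 t)"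
      "bounded_resolvent \<kappa> (\<lambda>s. f g s - f h s) (max 0 t) \<le> (\<kappa> / 2 * D) / \<kappa>"
      using bounded_resolvent_bounds[OF pos(1) continuous_on_diff[OF cf[OF g] cf[OF h]], of "max 0 t" "- (\<kappa> / 2 * D)" "\<kappa> / 2 * D"] fb
      by blast+
    ultimately show ?thesis using pos(1) by (simp add: abs_le_iff)
  qed
  obtain g where g: "?ok g" and g_fix: "\<And>t. F g t = g t"
  proof (rule bounded_function_fixed_point[of lo hi "1 / 2" F])
    note obt = that
    show "continuous_on UNIV (F g)" if "continuous_on UNIV g" "\<And>t. lo \<le> g t \<and> g t \<le> hi" for g
      by (rule cF) (use that in blast)
    show "lo \<le> F g t \<and> F g t \<le> hi" if "continuous_on UNIV g" "\<And>t. lo \<le> g t \<and> g t \<le> hi" for g t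
      by (rule range) (use that in blast)
    show "\<bar>F g t - F h t\<bar> \<le> 1 / 2 * D"
      if "continuous_on UNIV g" "\<And>t. lo \<le> g t \<and> g t \<le> hi"
        "continuous_on UNIV h" "\<And>t. lo \<le> h t \<and> h t \<le> hi" "\<And>t. \<bar>g t - h t\<bar> \<le> D" for g h D t
      by (rule contr[OF _ _ that(5)]) (use that in blast)+
    show thesis if "continuous_on UNIV g" "\<And>t. lo \<le> g t \<and> g t \<le> hi" "\<And>t. F g t = g t" for g
      by (rule obt[OF _ that(3)]) (use that in blast)
  qed (use lohi in simp_all)
  have gb: "0 < g t" "g t \<le> hi" for t using g pos(3) by (auto intro: less_le_trans[of 0 lo])
  have geq: "bounded_resolvent \<kappa> (f g) t = g t" if "t > 0" for t
    using g_fix[of t] that by (simp add: F_def)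
  have dg: "(g has_real_derivative (2 * d + \<delta>) * g t - 1 / Lam + p * E g t * (g t)\<^sup>2) (at t)" if t: "t > 0" for t
  proof -
    have "(bounded_resolvent \<kappa> (f g) has_real_derivative \<kappa> * bounded_resolvent \<kappa> (f g) t - f g t) (at t)"
      by (rule bounded_resolvent_deriv[OF pos(1) cf[OF g] f_abs[OF g] t])
    then have "(bounded_resolvent \<kappa> (f g) has_real_derivative (2 * d + \<delta>) * g t - 1 / Lam + p * E g t * (g t)\<^sup>2) (at t)"
      by (rule DERIV_cong, unfold geq[OF t]) (use t in \<open>simp add: f_def \<kappa>_def\<close>)
    then show ?thesis
      by (rule has_field_derivative_transform_within_open[of _ _ _ "{0<..}"]) (use t geq in auto)
  qed
  have ec: "continuous_on UNIV (\<lambda>s. exp (- \<delta> * s) * g s)"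
    using g by (intro continuous_on_mult continuous_intros) auto
  have dA: "(A g has_real_derivative exp (- \<delta> * t) * g t) (at t)" if "t > 0" for t
    using integral_from_zero_deriv[OF ec that] unfolding A_def[abs_def] .
  have dE: "(E g has_real_derivative - \<delta> * E g t - (p - 1) * (E g t)\<^sup>2 * g t) (at t)" if t: "t > 0" for t
  proof -
    define X where "X = exp (\<delta> * t)"
    define Y where "Y = 1 / \<eta>0 + (p - 1) * A g t"
    have E: "E g t = 1 / (X * Y)" by (simp add: E_def X_def Y_def)
    have XY: "X > 0" "X * Y > 0" using E0(1)[OF g, of t] t unfolding E by (auto simp: X_def)
    have dX: "((\<lambda>t. exp (\<delta> * t)) has_real_derivative \<delta> * X) (at t)"
      unfolding X_def by (auto intro!: derivative_eq_intros)
    have ex: "exp (- \<delta> * t) = 1 / X" by (simp add: X_def exp_minus inverse_eq_divide)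
    have dY: "((\<lambda>t. 1 / \<eta>0 + (p - 1) * A g t) has_real_derivative 0 + (p - 1) * (1 / X * g t)) (at t)"
      using dA[OF t] unfolding ex by (intro DERIV_add DERIV_const DERIV_cmult)
    have "Y \<noteq> 0" using XY by auto
    have XY0: "exp (\<delta> * t) * (1 / \<eta>0 + (p - 1) * A g t) \<noteq> 0" using XY(2) unfolding X_def Y_def by linarith
    have "(0 * (X * Y) - 1 * (\<delta> * X * Y + (0 + (p - 1) * (1 / X * g t)) * X)) / (X * Y * (X * Y))
      = - \<delta> * E g t - (p - 1) * (E g t)\<^sup>2 * g t"
      unfolding E using XY \<open>Y \<noteq> 0\<close> by (simp add: field_simps power2_eq_square)
    from DERIV_cong[OF DERIV_divide[OF DERIV_const DERIV_mult[OF dX dY] XY0], folded X_def Y_def, OF this]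
    have "((\<lambda>t. 1 / (exp (\<delta> * t) * (1 / \<eta>0 + (p - 1) * A g t))) has_real_derivative
      - \<delta> * E g t - (p - 1) * (E g t)\<^sup>2 * g t) (at t)" unfolding X_def Y_def .
    then show ?thesis unfolding E_def[abs_def] .
  qed
  \<comment> \<open>Here exp (\<delta> t) \<eta> = 1 / (1 / \<eta>0 + (p - 1) A), and
    \<open>A\<close> increases to a finite limit because its integrand is positive and decays
    exponentially.\<close>
  have lim_pos: "\<exists>c>0. ((\<lambda>t. exp (\<delta> * t) * E g t) \<longlongrightarrow> c) at_top" if \<delta>0: "\<delta> > 0"
  proof -
    have mono: "A g s \<le> A g t" if "0 < s" "s \<le> t" for s t
    proof (rule DERIV_nonneg_imp_nondecreasing[OF that(2)])
      fix x assume "s \<le> x" "x \<le> t"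
      then have "0 < x" using that by simp
      moreover have "0 \<le> exp (- \<delta> * x) * g x" using gb(1)[of x] by simp
      ultimately show "\<exists>w. (A g has_real_derivative w) (at x) \<and> 0 \<le> w" using dA by blast
    qed
    have bd: "A g t \<le> hi / \<delta>" if "0 < t" for t
    proof -
      have "\<bar>A g t\<bar> \<le> hi / \<delta>" unfolding A_def
      proof (rule integral_exp_decay_le[OF \<delta>0])
        show "(\<lambda>s. exp (- \<delta> * s) * g s) integrable_on {0..t}"
          by (intro integrable_continuous_real continuous_on_subset[OF ec]) simp
        show "\<bar>exp (- \<delta> * s) * g s\<bar> \<le> hi * exp (- \<delta> * s)" for s
          using gb[of s] by (simp add: abs_mult)
      qed (use that pos in auto)
      then show ?thesis by linarith
    qed
    obtain c where c: "(A g \<longlongrightarrow> c) at_top" "\<And>t. 0 < t \<Longrightarrow> A g t \<le> c"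
      using mono_bounded_tendsto_at_top[of "A g" "hi / \<delta>"] mono bd by blast
    have "0 \<le> c" using c(2)[of 1] A0[OF g, of 1] by linarith
    then have cp: "1 / \<eta>0 + (p - 1) * c > 0" using \<eta>0 pos by (simp add: add_pos_nonneg)
    have "exp (\<delta> * t) * E g t = 1 / (1 / \<eta>0 + (p - 1) * A g t)" for t by (simp add: E_def)
    moreover have "((\<lambda>t. 1 / (1 / \<eta>0 + (p - 1) * A g t)) \<longlongrightarrow> 1 / (1 / \<eta>0 + (p - 1) * c)) at_top"
      using cp by (intro tendsto_divide tendsto_add tendsto_mult tendsto_const c(1)) simp
    ultimately show ?thesis using cp by (intro exI[of _ "1 / (1 / \<eta>0 + (p - 1) * c)"]) simp
  qed
  \<comment> \<open>A bootstrap. From g \<ge> lo, 1 / \<eta> grows at least linearly; then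
    \<open>f\<close> is within O(1 / t) of 1 / Lam on \<open>{t..}\<close>, so \<open>g\<close> is
    within O(1 / t) of \<open>hi\<close>. Consequently the mean of \<open>g\<close> tends to
    \<open>hi\<close> and t \<eta> to 1 / ((p - 1) hi), where now hi = 1 / (2 d Lam).\<close>
  have lim_zero: "((\<lambda>t. t * E g t) \<longlongrightarrow> 2 * d * Lam / (p - 1)) at_top" if \<delta>0: "\<delta> = 0"
  proof -
    define C where "C = p * hi\<^sup>2 / ((p - 1) * lo)"
    have Eb: "E g s \<le> 1 / ((p - 1) * lo * t)" if "0 < t" "t \<le> s" for s t
    proof -
      have "J s = s" using that \<delta>0 by (simp add: J_def)
      then have "lo * s \<le> A g s" using A_lo[OF g, of s] by simp
      moreover have "lo * t \<le> lo * s" using that pos by simp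
      ultimately have "(p - 1) * (lo * t) \<le> (p - 1) * A g s"
        using pos order_trans[of "lo * t" "lo * s" "A g s"] by (intro mult_left_mono) simp_all
      moreover have "0 < 1 / \<eta>0" using \<eta>0 by simp
      ultimately have "(p - 1) * lo * t \<le> 1 / \<eta>0 + (p - 1) * A g s" unfolding mult.assoc by linarith
      moreover have "0 < (p - 1) * lo * t" using pos that by simp
      ultimately show ?thesis unfolding E_def using \<delta>0 by (simp add: frac_le)
    qed
    have g_lower: "hi - C / \<kappa> * (1 / t) \<le> g t" if "0 < t" for t
    proof -
      have "(1 / Lam - p * (1 / ((p - 1) * lo * t)) * hi\<^sup>2) / \<kappa> \<le> bounded_resolvent \<kappa> (f g) t"
      proof (rule bounded_resolvent_bounds(1)[OF pos(1) cf[OF g], where hi = "1 / Lam"])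
        fix s assume "t \<le> s"
        then have "E g (max 0 s) \<le> 1 / ((p - 1) * lo * t)" using Eb[OF that, of s] that by simp
        from f_lower[OF g this] f_upper[OF g, of s]
        show "1 / Lam - p * (1 / ((p - 1) * lo * t)) * hi\<^sup>2 \<le> f g s \<and> f g s \<le> 1 / Lam" by blast
      qed
      moreover have "(1 / Lam - p * (1 / ((p - 1) * lo * t)) * hi\<^sup>2) / \<kappa> = hi - C / \<kappa> * (1 / t)"
        unfolding kh[symmetric] C_def using pos that by (simp add: diff_divide_distrib mult_ac)
      ultimately show ?thesis using geq[OF that] by simp
    qed
    have "((\<lambda>t. hi - C / \<kappa> * (1 / t)) \<longlongrightarrow> hi - C / \<kappa> * 0) at_top"
      by (intro tendsto_diff tendsto_mult tendsto_const tendsto_divide_0[OF tendsto_const]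
          filterlim_at_top_imp_at_infinity filterlim_ident)
    then have "((\<lambda>t. hi - C / \<kappa> * (1 / t)) \<longlongrightarrow> hi) at_top" by simp
    then have glim: "(g \<longlongrightarrow> hi) at_top"
    proof (rule tendsto_sandwich[rotated 2])
      show "\<forall>\<^sub>F t in at_top. hi - C / \<kappa> * (1 / t) \<le> g t"
        using eventually_gt_at_top[of 0] by eventually_elim (rule g_lower)
      show "\<forall>\<^sub>F t in at_top. g t \<le> hi" using gb(2) by simp
    qed simp
    have "((\<lambda>t. A g t / t) \<longlongrightarrow> hi) at_top"
    proof (rule lhospital_at_top_at_top[where f' = "\<lambda>t. exp (- \<delta> * t) * g t" and g' = "\<lambda>_. 1"])
      show "\<forall>\<^sub>F t in at_top. (A g has_real_derivative exp (- \<delta> * t) * g t) (at t)"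
        using eventually_gt_at_top[of 0] by eventually_elim (rule dA)
      show "((\<lambda>t. exp (- \<delta> * t) * g t / 1) \<longlongrightarrow> hi) at_top" using glim \<delta>0 by simp
    qed (auto intro: filterlim_ident)
    moreover have "((\<lambda>t. 1 / \<eta>0 / t) \<longlongrightarrow> 0) at_top"
      by (intro tendsto_divide_0[OF tendsto_const] filterlim_at_top_imp_at_infinity filterlim_ident)
    ultimately have "((\<lambda>t. 1 / (1 / \<eta>0 / t + (p - 1) * (A g t / t))) \<longlongrightarrow> 1 / (0 + (p - 1) * hi)) at_top"
      using pos by (intro tendsto_divide tendsto_add tendsto_mult tendsto_const) auto
    then have L: "((\<lambda>t. 1 / (1 / \<eta>0 / t + (p - 1) * (A g t / t))) \<longlongrightarrow> 2 * d * Lam / (p - 1)) at_top"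
      using \<delta>0 by (simp add: hi_def \<kappa>_def mult_ac)
    show ?thesis
    proof (rule Lim_transform_eventually[OF L])
      have "1 / (1 / \<eta>0 / t + (p - 1) * (A g t / t)) = t * E g t" if "0 < t" for t
      proof -
        have "1 / \<eta>0 / t + (p - 1) * (A g t / t) = (1 / \<eta>0 + (p - 1) * A g t) / t"
          by (simp add: add_divide_distrib)
        then show ?thesis using \<delta>0 by (simp add: E_def)
      qed
      then show "\<forall>\<^sub>F t in at_top. 1 / (1 / \<eta>0 / t + (p - 1) * (A g t / t)) = t * E g t"
        using eventually_gt_at_top[of 0] by (rule eventually_mono[rotated])
    qed
  qed
  show thesis
  proof (rule that[of "E g" g])
    fix t :: real assume t: "0 < t"
    show E: "0 < E g t" using E0(1)[OF g] t by simp
    show "0 < E g t * g t" using E gb by simp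
    have "E g t * g t \<le> \<eta>0 * hi" using E0[OF g, of t] gb[of t] t \<eta>0 by (intro mult_mono) auto
    then show "E g t * g t \<le> b" using small' by linarith
  qed (use dE dg lim_pos lim_zero in \<open>auto\<close>)
qed

subsection \<open>Singular solutions\<close>

text \<open>With \<alpha> = 2 / (p - 1) the quantity \<xi> is constant along U = K exp (\<alpha> t),
  and a = \<alpha> is an equilibrium of the Riccati equation exactly when \<xi> = (\<alpha> -
  \<tau>p) (\<alpha> - \<tau>m). This fixes K and requires the product to be positive. The convexity
  expression is then \<alpha>^2 + \<alpha>.\<close>

lemma pure_power_solution:
  assumes pos: "0 < Lam" "CARD('n::finite) \<ge> 2" and p: "p > 1"
    and lam: "lam * (real CARD('n) - 1) = Lam * (\<tau>p + \<tau>m + 1)" and mu: "mu = Lam * (\<tau>p * \<tau>m)"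
    and sgn: "0 < (2 / (p - 1) - \<tau>p) * (2 / (p - 1) - \<tau>m)"
  shows "\<exists>u :: real^'n \<Rightarrow> real. is_solution lam Lam mu p u \<and>
    ((\<lambda>x. norm x powr (2 / (p - 1)) * u x) \<longlongrightarrow>
      (Lam * (2 / (p - 1) - \<tau>p) * (2 / (p - 1) - \<tau>m)) powr (1 / (p - 1))) (at 0)"
proof -
  define \<alpha> where "\<alpha> = 2 / (p - 1)"
  define s where "s = (\<alpha> - \<tau>p) * (\<alpha> - \<tau>m)"
  define K where "K = (Lam * s) powr (1 / (p - 1))"
  define U where "U t = K * exp (\<alpha> * t)" for t
  have s: "s > 0" using sgn by (simp add: s_def \<alpha>_def)
  have "p - 1 \<noteq> 0" using p by simp
  then have \<alpha>: "\<alpha> * (p - 1) = 2" by (metis \<alpha>_def nonzero_eq_divide_eq)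
  have \<alpha>0: "\<alpha> > 0" using p by (simp add: \<alpha>_def)
  have K: "K > 0" using s pos by (simp add: K_def)
  have Kp: "K powr (p - 1) = Lam * s" using s pos p by (simp add: K_def powr_powr)
  have \<xi>: "exp (- 2 * t) * U t powr (p - 1) / Lam = s" for t
  proof -
    have "exp (\<alpha> * t) powr (p - 1) = exp (2 * t)"
      using \<alpha> by (simp add: powr_def) (metis mult.assoc mult.commute)
    then have "exp (- 2 * t) * U t powr (p - 1) / Lam = (exp (- 2 * t) * exp (2 * t)) * s"
      using K pos by (simp add: U_def powr_mult Kp)
    then show ?thesis by (simp flip: exp_add)
  qed
  have "is_solution lam Lam mu p (\<lambda>x::real^'n. U (- ln (norm x)))"
  proof (rule is_solution_of_riccati[OF pos lam mu, where a = "\<lambda>_. \<alpha>"])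
    fix t :: real
    show "U t > 0" using K by (simp add: U_def)
    show "(U has_real_derivative \<alpha> * U t) (at t)"
      unfolding U_def[abs_def] by (auto intro!: derivative_eq_intros)
    show "((\<lambda>_. \<alpha>) has_real_derivative exp (- 2 * t) * U t powr (p - 1) / Lam - (\<alpha> - \<tau>p) * (\<alpha> - \<tau>m)) (at t)"
      unfolding \<xi> s_def by simp
    have "(\<tau>p + \<tau>m + 1) * \<alpha> - \<tau>p * \<tau>m + s = \<alpha> * \<alpha> + \<alpha>" by (simp add: s_def algebra_simps)
    then show "0 < (\<tau>p + \<tau>m + 1) * \<alpha> - \<tau>p * \<tau>m + exp (- 2 * t) * U t powr (p - 1) / Lam"
      unfolding \<xi> using \<alpha>0 by (simp add: add_pos_pos)
  qed (rule \<alpha>0)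
  moreover have "((\<lambda>x::real^'n. norm x powr \<alpha> * U (- ln (norm x))) \<longlongrightarrow> K) (at 0)"
  proof (rule radial_powr_tendsto)
    have "exp (- \<alpha> * t) * U t = K" for t by (simp add: U_def flip: exp_add)
    then show "((\<lambda>t. exp (- \<alpha> * t) * U t) \<longlongrightarrow> K) at_top" by simp
  qed
  ultimately show ?thesis unfolding K_def s_def \<alpha>_def mult.assoc by blast
qed

text \<open>The profile equation below is the one satisfied by \<open>y = exp (- \<tau>p * t) * U(t)\<close>, up to a scaling
  of \<open>U\<close> that turns \<open>1 / Lam\<close> into the free constant \<open>\<epsilon>\<close>.\<close>
lemma fast_singular_solution:
  assumes pos: "0 < Lam" "CARD('n::finite) \<ge> 2" and p: "p > 1" and \<tau>: "0 < \<tau>m" "\<tau>m < \<tau>p"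
    and lam: "lam * (real CARD('n) - 1) = Lam * (\<tau>p + \<tau>m + 1)" and mu: "mu = Lam * (\<tau>p * \<tau>m)"
    and sub: "(p - 1) * \<tau>p < 2"
  shows "\<exists>u :: real^'n \<Rightarrow> real. is_solution lam Lam mu p u \<and>
    (\<exists>c>0. ((\<lambda>x. norm x powr \<tau>p * u x) \<longlongrightarrow> c) (at 0))"
proof -
  define d where "d = (\<tau>p - \<tau>m) / 2"
  define \<delta> where "\<delta> = 2 - (p - 1) * \<tau>p"
  have "d > 0" "\<delta> > 0" using \<tau> sub by (auto simp: d_def \<delta>_def)
  then obtain \<epsilon> c y z where \<epsilon>: "\<epsilon> > 0" and c: "c > 0" and y: "\<And>t. t > 0 \<Longrightarrow> y t > 0" and z: "\<And>t. t > 0 \<Longrightarrow> z t \<ge> 0"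
    and dy: "\<And>t. t > 0 \<Longrightarrow> (y has_real_derivative z t) (at t)"
    and dz: "\<And>t. t > 0 \<Longrightarrow> (z has_real_derivative - 2 * d * z t + \<epsilon> * exp (- \<delta> * t) * y t powr p) (at t)"
    and lim: "(y \<longlongrightarrow> c) at_top"
    using regular_profile[OF _ _ p] by metis
  \<comment> \<open>The scaling for which \<open>k powr (p - 1) / Lam\<close> is the \<epsilon> of
    the profile.\<close>
  define k where "k = (\<epsilon> * Lam) powr (1 / (p - 1))"
  have k: "k > 0" "k powr (p - 1) = \<epsilon> * Lam" using \<epsilon> pos p by (auto simp: k_def powr_powr)
  define U where "U t = k * exp (\<tau>p * t) * y t" for t
  define a where "a t = \<tau>p + z t / y t" for t
  have \<xi>: "exp (- 2 * t) * U t powr (p - 1) / Lam = \<epsilon> * exp (- \<delta> * t) * y t powr (p - 1)" if "t > 0" for t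
  proof -
    have "exp (- 2 * t) * exp (\<tau>p * t) powr (p - 1) = exp (- \<delta> * t)"
      by (simp add: powr_def \<delta>_def algebra_simps flip: exp_add)
    moreover have "exp (- 2 * t) * U t powr (p - 1) / Lam
      = \<epsilon> * (exp (- 2 * t) * exp (\<tau>p * t) powr (p - 1)) * y t powr (p - 1)"
      using k y[OF that] pos by (simp add: U_def powr_mult)
    ultimately show ?thesis by simp
  qed
  have "is_solution lam Lam mu p (\<lambda>x::real^'n. U (- ln (norm x)))"
  proof (rule is_solution_of_riccati[OF pos lam mu, where a = a])
    fix t :: real assume t: "t > 0"
    have y0: "y t \<noteq> 0" using y[OF t] by simp
    show "U t > 0" using k y[OF t] by (simp add: U_def)
    show "(U has_real_derivative a t * U t) (at t)"
      unfolding U_def[abs_def] a_def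
      by (rule derivative_eq_intros dy[OF t] refl)+ (use y0 in \<open>simp add: field_simps\<close>)
    show "(a has_real_derivative exp (- 2 * t) * U t powr (p - 1) / Lam - (a t - \<tau>p) * (a t - \<tau>m)) (at t)"
      unfolding \<xi>[OF t] a_def[abs_def]
    proof (rule DERIV_cong[OF DERIV_add[OF DERIV_const DERIV_divide[OF dz[OF t] dy[OF t] y0]]])
      have "y t powr p = y t * y t powr (p - 1)" using y[OF t] by (simp add: powr_mult_base)
      then show "0 + ((- 2 * d * z t + \<epsilon> * exp (- \<delta> * t) * y t powr p) * y t - z t * z t) / (y t * y t)
        = \<epsilon> * exp (- \<delta> * t) * y t powr (p - 1) - (\<tau>p + z t / y t - \<tau>p) * (\<tau>p + z t / y t - \<tau>m)"
        using y0 by (simp add: d_def field_simps)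
    qed
    have a: "\<tau>p \<le> a t" using z[OF t] y[OF t] by (simp add: a_def)
    then show "a t > 0" using \<tau> by simp
    \<comment> \<open>Without \<xi>, the convexity expression increases with \<open>a\<close> and
      equals \<tau>p^2 + \<tau>p at a = \<tau>p, which is the least possible value of
      \<open>a\<close> here.\<close>
    have "(\<tau>p + \<tau>m + 1) * \<tau>p \<le> (\<tau>p + \<tau>m + 1) * a t" using a \<tau> by (intro mult_left_mono) auto
    moreover have "(\<tau>p + \<tau>m + 1) * \<tau>p - \<tau>p * \<tau>m = \<tau>p * \<tau>p + \<tau>p" by (simp add: algebra_simps)
    moreover have "0 < \<tau>p * \<tau>p + \<tau>p" using \<tau> by (simp add: add_pos_pos)
    moreover have "0 \<le> exp (- 2 * t) * U t powr (p - 1) / Lam" using pos by simp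
    ultimately show "0 < (\<tau>p + \<tau>m + 1) * a t - \<tau>p * \<tau>m + exp (- 2 * t) * U t powr (p - 1) / Lam"
      by linarith
  qed
  moreover have "((\<lambda>x::real^'n. norm x powr \<tau>p * U (- ln (norm x))) \<longlongrightarrow> k * c) (at 0)"
  proof (rule radial_powr_tendsto)
    have "exp (- \<tau>p * t) * U t = k * y t * (exp (- \<tau>p * t) * exp (\<tau>p * t))" for t by (simp add: U_def)
    then have "exp (- \<tau>p * t) * U t = k * y t" for t by (simp flip: exp_add)
    then show "((\<lambda>t. exp (- \<tau>p * t) * U t) \<longlongrightarrow> k * c) at_top"
      using tendsto_mult[OF tendsto_const lim] by simp
  qed
  moreover have "k * c > 0" using k c by simp
  ultimately show ?thesis by blast
qed

text \<open>The system for \<eta> and \<open>g\<close> is turned back into \<open>U\<close> through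
  U^(p - 1) = \<eta> exp (2 t). The gap \<delta> = 2 - (p - 1) \<tau>m is positive below the
  critical exponent and zero at it, so one construction covers both regimes and only the decay of
  \<eta> differs: exponential in the first, like 1 / t in the second.\<close>

lemma slow_singular_solution:
  assumes pos: "0 < Lam" "CARD('n::finite) \<ge> 2" and p: "p > 1" and \<tau>: "0 < \<tau>m" "\<tau>m < \<tau>p"
    and lam: "lam * (real CARD('n) - 1) = Lam * (\<tau>p + \<tau>m + 1)" and mu: "mu = Lam * (\<tau>p * \<tau>m)"
    and sub: "(p - 1) * \<tau>m \<le> 2"
  shows "\<exists>u :: real^'n \<Rightarrow> real. is_solution lam Lam mu p u \<and>
    ((p - 1) * \<tau>m < 2 \<longrightarrow> (\<exists>c>0. ((\<lambda>x. norm x powr \<tau>m * u x) \<longlongrightarrow> c) (at 0))) \<and>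
    ((p - 1) * \<tau>m = 2 \<longrightarrow> ((\<lambda>x. norm x powr \<tau>m * (- ln (norm x)) powr (\<tau>m / 2) * u x)
      \<longlongrightarrow> (Lam * \<tau>m * ((\<tau>p - \<tau>m) / 2)) powr (\<tau>m / 2)) (at 0))"
proof -
  define d where "d = (\<tau>p - \<tau>m) / 2"
  define \<delta> where "\<delta> = 2 - (p - 1) * \<tau>m"
  \<comment> \<open>Chosen so that \<open>(\<tau>p + \<tau>m + 1) * b\<close> is \<tau>m / 2: the
    deviation of \<open>a\<close> from \<tau>m then costs at most half of the term \<tau>m in the
    convexity expression, and \<open>a\<close> stays positive.\<close>
  define b where "b = \<tau>m / 2 / (\<tau>p + \<tau>m + 1)"
  have "d > 0" "\<delta> \<ge> 0" "b > 0" using \<tau> sub by (auto simp: d_def \<delta>_def b_def)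
  from center_profile[OF this(1,2) p pos(1) this(3)]
  obtain \<eta> g where \<eta>: "\<And>t. t > 0 \<Longrightarrow> \<eta> t > 0" and \<eta>g: "\<And>t. t > 0 \<Longrightarrow> \<eta> t * g t > 0" "\<And>t. t > 0 \<Longrightarrow> \<eta> t * g t \<le> b"
    and d\<eta>: "\<And>t. t > 0 \<Longrightarrow> (\<eta> has_real_derivative - \<delta> * \<eta> t - (p - 1) * (\<eta> t)\<^sup>2 * g t) (at t)"
    and dg: "\<And>t. t > 0 \<Longrightarrow> (g has_real_derivative (2 * d + \<delta>) * g t - 1 / Lam + p * \<eta> t * (g t)\<^sup>2) (at t)"
    and lim_pos: "\<delta> > 0 \<Longrightarrow> \<exists>c>0. ((\<lambda>t. exp (\<delta> * t) * \<eta> t) \<longlongrightarrow> c) at_top"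
    and lim_zero: "\<delta> = 0 \<Longrightarrow> ((\<lambda>t. t * \<eta> t) \<longlongrightarrow> 2 * d * Lam / (p - 1)) at_top"
    by blast
  define U where "U t = (\<eta> t * exp (2 * t)) powr (1 / (p - 1))" for t
  define a where "a t = \<tau>m - \<eta> t * g t" for t
  have \<xi>: "exp (- 2 * t) * U t powr (p - 1) / Lam = \<eta> t / Lam" if "t > 0" for t
  proof -
    have "U t powr (p - 1) = \<eta> t * exp (2 * t)" using \<eta>[OF that] p by (simp add: U_def powr_powr)
    then have "exp (- 2 * t) * U t powr (p - 1) = \<eta> t * (exp (- 2 * t) * exp (2 * t))" by simp
    then show ?thesis by (simp flip: exp_add)
  qed
  have "is_solution lam Lam mu p (\<lambda>x::real^'n. U (- ln (norm x)))"
  proof (rule is_solution_of_riccati[OF pos lam mu, where a = a])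
    fix t :: real assume t: "t > 0"
    let ?V = "\<eta> t * exp (2 * t)"
    have V: "?V > 0" using \<eta>[OF t] by simp
    show "U t > 0" using \<eta>[OF t] by (simp add: U_def)
    have dexp: "((\<lambda>t. exp (2 * t)) has_real_derivative 2 * exp (2 * t)) (at t)"
      by (auto intro!: derivative_eq_intros)
    \<comment> \<open>The logarithmic derivative of \<eta> exp (2 t) is 2 - \<delta> - (p - 1)
      \<eta> g, which is (p - 1) a because 2 - \<delta> = (p - 1) \<tau>m.\<close>
    have dV: "((\<lambda>t. \<eta> t * exp (2 * t)) has_real_derivative (p - 1) * a t * ?V) (at t)"
      by (rule DERIV_cong[OF DERIV_mult[OF d\<eta>[OF t] dexp]])
         (simp add: a_def \<delta>_def power2_eq_square algebra_simps)
    have "v powr (q - 1) * v = v powr q" if "0 < v" for v q :: real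
      using that powr_mult_base[of v "q - 1"] by (simp add: mult.commute)
    from this[OF V, of "1 / (p - 1)"] have "?V powr (1 / (p - 1) - 1) * ?V = U t" unfolding U_def .
    then have "1 / (p - 1) * ?V powr (1 / (p - 1) - 1) * ((p - 1) * a t * ?V) = a t * U t"
      using p by (simp add: mult_ac)
    with DERIV_chain2[where f = "\<lambda>v. v powr (1 / (p - 1))", OF has_real_derivative_powr[OF V] dV]
    show "(U has_real_derivative a t * U t) (at t)" unfolding U_def[abs_def] by (simp only:)
    \<comment> \<open>In (\<eta> g)' the \<delta>-terms cancel and the quadratic ones combine to
      (\<eta> g)^2, which leaves a' = \<eta> / Lam - (2 d + \<eta> g) \<eta> g.\<close>
    show "(a has_real_derivative exp (- 2 * t) * U t powr (p - 1) / Lam - (a t - \<tau>p) * (a t - \<tau>m)) (at t)"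
      unfolding \<xi>[OF t] a_def[abs_def]
      by (rule DERIV_cong[OF DERIV_diff[OF DERIV_const DERIV_mult[OF d\<eta>[OF t] dg[OF t]]]])
         (simp add: d_def power2_eq_square algebra_simps add_divide_distrib diff_divide_distrib)
    have a: "\<tau>m - b \<le> a t" using \<eta>g(2)[OF t] by (simp add: a_def)
    have T: "\<tau>p + \<tau>m + 1 > 0" using \<tau> by simp
    then have Tb: "(\<tau>p + \<tau>m + 1) * b = \<tau>m / 2"
      using nonzero_eq_divide_eq[of "\<tau>p + \<tau>m + 1" b "\<tau>m / 2"] by (simp add: b_def mult.commute)
    have "b \<le> (\<tau>p + \<tau>m + 1) * b" using \<open>b > 0\<close> \<tau> by (simp add: algebra_simps)
    then show "a t > 0" using a \<tau> Tb by linarith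
    have "(\<tau>p + \<tau>m + 1) * (\<tau>m - b) \<le> (\<tau>p + \<tau>m + 1) * a t" using a T by (intro mult_left_mono) auto
    moreover have "(\<tau>p + \<tau>m + 1) * (\<tau>m - b) - \<tau>p * \<tau>m = \<tau>m * \<tau>m + \<tau>m - (\<tau>p + \<tau>m + 1) * b"
      by (simp add: algebra_simps)
    moreover have "0 < \<tau>m * \<tau>m" using \<tau> by simp
    moreover have "0 \<le> exp (- 2 * t) * U t powr (p - 1) / Lam" using pos by simp
    ultimately show "0 < (\<tau>p + \<tau>m + 1) * a t - \<tau>p * \<tau>m + exp (- 2 * t) * U t powr (p - 1) / Lam"
      using Tb \<tau> by linarith
  qed
  moreover have eU: "exp (- \<tau>m * t) * U t = (exp (\<delta> * t) * \<eta> t) powr (1 / (p - 1))" if "t > 0" for t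
  proof -
    have "exp ((p - 1) * x) powr (1 / (p - 1)) = exp x" for x using p by (simp add: powr_def)
    from this[of "- \<tau>m * t"]
    have "exp (- \<tau>m * t) * U t = exp ((p - 1) * (- \<tau>m * t)) powr (1 / (p - 1)) * (\<eta> t * exp (2 * t)) powr (1 / (p - 1))"
      by (simp only: U_def)
    also have "\<dots> = (exp ((p - 1) * (- \<tau>m * t)) * (\<eta> t * exp (2 * t))) powr (1 / (p - 1))"
      by (rule powr_mult[symmetric])
    also have "exp ((p - 1) * (- \<tau>m * t)) * (\<eta> t * exp (2 * t)) = exp (\<delta> * t) * \<eta> t"
      by (simp add: \<delta>_def algebra_simps flip: exp_add)
    finally show ?thesis .
  qed
  moreover have "\<exists>c>0. ((\<lambda>x::real^'n. norm x powr \<tau>m * U (- ln (norm x))) \<longlongrightarrow> c) (at 0)" if "(p - 1) * \<tau>m < 2"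
  proof -
    have "\<delta> > 0" using that by (simp add: \<delta>_def)
    from lim_pos[OF this] obtain c where c: "c > 0" "((\<lambda>t. exp (\<delta> * t) * \<eta> t) \<longlongrightarrow> c) at_top" by blast
    have "((\<lambda>t. (exp (\<delta> * t) * \<eta> t) powr (1 / (p - 1))) \<longlongrightarrow> c powr (1 / (p - 1))) at_top"
      using c by (intro tendsto_powr tendsto_const) auto
    then have "((\<lambda>t. exp (- \<tau>m * t) * U t) \<longlongrightarrow> c powr (1 / (p - 1))) at_top"
    proof (rule Lim_transform_eventually)
      show "\<forall>\<^sub>F t in at_top. (exp (\<delta> * t) * \<eta> t) powr (1 / (p - 1)) = exp (- \<tau>m * t) * U t"
        using eventually_gt_at_top[of 0] by eventually_elim (rule eU[symmetric])
    qed
    from radial_powr_tendsto[OF this] c(1) show ?thesis by (intro exI[of _ "c powr (1 / (p - 1))"]) simp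
  qed
  moreover have "((\<lambda>x::real^'n. norm x powr \<tau>m * (- ln (norm x)) powr (\<tau>m / 2) * U (- ln (norm x)))
      \<longlongrightarrow> (Lam * \<tau>m * ((\<tau>p - \<tau>m) / 2)) powr (\<tau>m / 2)) (at 0)" if crit: "(p - 1) * \<tau>m = 2"
  proof -
    have \<delta>: "\<delta> = 0" using crit by (simp add: \<delta>_def)
    \<comment> \<open>At the critical exponent 1 / (p - 1) is \<tau>m / 2, the power of the
      logarithm; it also turns the limit of t \<eta> into \<open>Lam * \<tau>m * d\<close>.\<close>
    have ip: "1 / (p - 1) = \<tau>m / 2" using crit p by (simp add: field_simps)
    have "2 * d * Lam / (p - 1) = 2 * d * Lam * (1 / (p - 1))" by simp
    also have "\<dots> = Lam * \<tau>m * d" unfolding ip by simp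
    finally have L: "((\<lambda>t. t * \<eta> t) \<longlongrightarrow> Lam * \<tau>m * d) at_top" using lim_zero[OF \<delta>] by simp
    have "((\<lambda>t. (t * \<eta> t) powr (\<tau>m / 2)) \<longlongrightarrow> (Lam * \<tau>m * d) powr (\<tau>m / 2)) at_top"
      using pos \<tau> \<open>d > 0\<close> by (intro tendsto_powr[OF L] tendsto_const) auto
    then have "((\<lambda>t. exp (- \<tau>m * t) * (t powr (\<tau>m / 2) * U t)) \<longlongrightarrow> (Lam * \<tau>m * d) powr (\<tau>m / 2)) at_top"
    proof (rule Lim_transform_eventually)
      have "(t * \<eta> t) powr (\<tau>m / 2) = exp (- \<tau>m * t) * (t powr (\<tau>m / 2) * U t)" if "0 < t" for t
        using eU[OF that] \<eta>[OF that] that unfolding \<delta> ip by (simp add: powr_mult)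
      then show "\<forall>\<^sub>F t in at_top. (t * \<eta> t) powr (\<tau>m / 2) = exp (- \<tau>m * t) * (t powr (\<tau>m / 2) * U t)"
        using eventually_gt_at_top[of 0] by (rule eventually_mono[rotated])
    qed
    from radial_powr_tendsto[OF this] show ?thesis by (simp add: d_def mult.assoc)
  qed
  ultimately show ?thesis by blast
qed

theorem theorem1p1:
  fixes lam Lam mu p N Nt \<tau> lambda_bar \<tau>p \<tau>m p_star p_sstar K Kbar :: real
  assumes "0 < lam" and "lam \<le> Lam"
    and "N = real CARD('n::finite)"
    and "Nt = lam / Lam * (N - 1) + 1" and "Nt > 2"
    and "\<tau> = (Nt - 2) / 2"
    and "lambda_bar = Lam * \<tau>\<^sup>2"
    and "0 < mu" and "mu < lambda_bar" and "p > 1"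
    and "\<tau>p = \<tau> + sqrt (\<tau>\<^sup>2 - mu / Lam)"
    and "\<tau>m = \<tau> - sqrt (\<tau>\<^sup>2 - mu / Lam)"
    and "p_star = 1 + 2 / \<tau>p"
    and "p_sstar = 1 + 2 / \<tau>m"
    and "K = (Lam * (2 / (p - 1) - \<tau>p) * (2 / (p - 1) - \<tau>m)) powr (1 / (p - 1))"
    and "Kbar = (Lam * \<tau>m * (\<tau> - \<tau>m)) powr (\<tau>m / 2)"
  shows
    "(p < p_star \<longrightarrow>
        (\<exists>u :: real^'n \<Rightarrow> real. is_solution lam Lam mu p u \<and>
           ((\<lambda>x. norm x powr (2 / (p - 1)) * u x) \<longlongrightarrow> K) (at 0)) \<and>
        (\<exists>v :: real^'n \<Rightarrow> real. is_solution lam Lam mu p v \<and>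
           (\<exists>c1>0. ((\<lambda>x. norm x powr \<tau>p * v x) \<longlongrightarrow> c1) (at 0))) \<and>
        (\<exists>w :: real^'n \<Rightarrow> real. is_solution lam Lam mu p w \<and>
           (\<exists>c2>0. ((\<lambda>x. norm x powr \<tau>m * w x) \<longlongrightarrow> c2) (at 0)))) \<and>
     (p_star \<le> p \<and> p < p_sstar \<longrightarrow>
        (\<exists>u :: real^'n \<Rightarrow> real. is_solution lam Lam mu p u \<and>
           (\<exists>c2>0. ((\<lambda>x. norm x powr \<tau>m * u x) \<longlongrightarrow> c2) (at 0)))) \<and>
     (p = p_sstar \<longrightarrow>
        (\<exists>u :: real^'n \<Rightarrow> real. is_solution lam Lam mu p u \<and>
           ((\<lambda>x. norm x powr \<tau>m * (- ln (norm x)) powr (\<tau>m / 2) * u x) \<longlongrightarrow> Kbar) (at 0))) \<and>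
     (p > p_sstar \<longrightarrow>
        (\<exists>u :: real^'n \<Rightarrow> real. is_solution lam Lam mu p u \<and>
           ((\<lambda>x. norm x powr (2 / (p - 1)) * u x) \<longlongrightarrow> K) (at 0)))"
proof -
  define D where "D = sqrt (\<tau>\<^sup>2 - mu / Lam)"
  have Lam: "0 < Lam" using assms(1,2) by linarith
  \<comment> \<open>As lam / Lam is at most 1, the condition Nt > 2 leaves no room for N \<le>
    2.\<close>
  have "N - 1 > 1"
  proof (rule ccontr)
    assume "\<not> N - 1 > 1"
    then have "lam / Lam * (N - 1) \<le> lam / Lam * 1"
      using assms(1) Lam by (intro mult_left_mono) auto
    moreover have "lam / Lam \<le> 1" using assms(2) Lam by simp
    ultimately show False using assms(4,5) by linarith
  qed
  then have N: "CARD('n) \<ge> 2" using assms(3) by simp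
  have \<tau>0: "\<tau> > 0" using assms(5,6) by simp
  have mL: "0 < mu / Lam" "mu / Lam < \<tau>\<^sup>2" using assms(7-9) Lam by (auto simp: field_simps)
  have D: "0 < D" "D\<^sup>2 = \<tau>\<^sup>2 - mu / Lam" using mL by (auto simp: D_def)
  have "D\<^sup>2 < \<tau>\<^sup>2" using D mL by simp
  then have "D < \<tau>" using \<tau>0 by (simp add: power2_less_imp_less)
  have \<tau>pm: "\<tau>p = \<tau> + D" "\<tau>m = \<tau> - D" using assms(11,12) by (simp_all add: D_def)
  have \<tau>: "0 < \<tau>m" "\<tau>m < \<tau>p" using \<open>D < \<tau>\<close> D \<tau>pm by auto
  \<comment> \<open>Vieta: \<tau>p and \<tau>m have sum 2 \<tau> = Nt - 2 and product mu / Lam,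
    which turns the coefficients of the equation into those of the Riccati form.\<close>
  have lam: "lam * (real CARD('n) - 1) = Lam * (\<tau>p + \<tau>m + 1)"
  proof -
    have "\<tau>p + \<tau>m + 1 = Nt - 1" by (simp add: \<tau>pm assms(6))
    also have "\<dots> = lam / Lam * (N - 1)" by (simp add: assms(4))
    finally show ?thesis using Lam assms(3) by simp
  qed
  have "\<tau>p * \<tau>m = mu / Lam" using D by (simp add: \<tau>pm algebra_simps power2_eq_square)
  then have mu: "mu = Lam * (\<tau>p * \<tau>m)" using Lam by simp
  have p1: "p - 1 > 0" using assms(10) by simp
  have star: "p < p_star \<longleftrightarrow> (p - 1) * \<tau>p < 2" "p < p_sstar \<longleftrightarrow> (p - 1) * \<tau>m < 2"
    "p = p_sstar \<longleftrightarrow> (p - 1) * \<tau>m = 2"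
    using \<tau> unfolding assms(13,14) by (auto simp: field_simps)
  have ratio: "(p - 1) * x < 2 \<longleftrightarrow> x < 2 / (p - 1)" for x using p1 by (simp add: field_simps)
  have less: "(p - 1) * \<tau>m < (p - 1) * \<tau>p" using p1 \<tau> by simp
  have Kbar: "Kbar = (Lam * \<tau>m * ((\<tau>p - \<tau>m) / 2)) powr (\<tau>m / 2)"
    using assms(16) by (simp add: \<tau>pm)
  note sols = pure_power_solution[OF Lam N assms(10) lam mu, folded assms(15)]
    fast_singular_solution[OF Lam N assms(10) \<tau> lam mu] slow_singular_solution[OF Lam N assms(10) \<tau> lam mu, folded Kbar]
  \<comment> \<open>Below \<open>p_star\<close> the exponent 2 / (p - 1) exceeds both roots, above
    \<open>p_sstar\<close> it lies below both; either way the product in \<open>K\<close> is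
    positive.\<close>
  have A: "0 < (2 / (p - 1) - \<tau>p) * (2 / (p - 1) - \<tau>m)" if "p < p_star"
    using that less unfolding star by (intro mult_pos_pos) (simp_all add: ratio[symmetric])
  have A': "0 < (2 / (p - 1) - \<tau>p) * (2 / (p - 1) - \<tau>m)" if "p > p_sstar"
  proof -
    have "2 < (p - 1) * \<tau>m" using that star(2,3) by linarith
    then have "2 / (p - 1) < \<tau>m" using p1 by (simp add: field_simps)
    then show ?thesis using \<tau> by (intro mult_neg_neg) auto
  qed
  have S: "\<exists>u :: real^'n \<Rightarrow> real. is_solution lam Lam mu p u \<and>
      (\<exists>c>0. ((\<lambda>x. norm x powr \<tau>m * u x) \<longlongrightarrow> c) (at 0))" if "p < p_sstar"
    using sols(3) that unfolding star by force
  have C: "\<exists>u :: real^'n \<Rightarrow> real. is_solution lam Lam mu p u \<and>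
      ((\<lambda>x. norm x powr \<tau>m * (- ln (norm x)) powr (\<tau>m / 2) * u x) \<longlongrightarrow> Kbar) (at 0)" if "p = p_sstar"
    using sols(3) that unfolding star by force
  have lt: "p < p_sstar" if "p < p_star" using that less unfolding star by linarith
  show ?thesis
    using sols(1)[OF A] sols(1)[OF A'] sols(2) S C lt star(1) by blast
qed

end
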